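(* Let $J$ be a WOT-closed two-sided ideal of $F_n^\infty$ such that $1\in\mathcal N_J$ and let $\mathcal D$ be a Hilbert space. If $\mathcal M\subseteq\mathcal N_J\otimes\mathcal D$ is a co-invariant subspace under $B_i\otimes I_{\mathcal D}$, $i=1,\ldots,n$, then there exists a subspace $\mathcal E\subseteq\mathcal D$ such that $$\overline{\mathrm{span}}\left\{(B_\alpha\otimes I_{\mathcal D})\mathcal M:\ \alpha\in\mathbb F_n^+\right\}=\mathcal N_J\otimes\mathcal E.$$
   Context: Let $n\in\{1,2,\dots\}$ and let $F^2(H_n)=\bigoplus_{k\ge 0}H_n^{\otimes k}$ be the full Fock space of an $n$-dimensional complex Hilbert space $H_n$ with orthonormal basis $e_1,\dots,e_n$ (with $H_n^{\otimes 0}=\mathbb C1$). The left creation operators are $S_i\varphi=e_i\otimes\varphi$. $F_n^\infty\subset B(F^2(H_n))$ is the WOT-closed algebra generated by $S_1,\dots,S_n$ and the identity. For a WOT-closed two-sided ideal $J$ of $F_n^\infty$, put $\mathcal N_J=F^2(H_n)\ominus\overline{JF^2(H_n)}$ and $B_i=P_{\mathcal N_J}S_i|_{\mathcal N_J}$. $\mathbb F_n^+$ is the unital free semigroup on generators $g_1,\dots,g_n$ with identity $g_0$; $B_\alpha=B_{i_1}\cdots B_{i_k}$ if $\alpha=g_{i_1}\cdots g_{i_k}$, and $B_{g_0}=I$. A subspace is co-invariant under a set of operators if it is invariant under their adjoints. *)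

theory Defs
  imports "HOL-Analysis.Analysis"
begin

section \<open>Complex Hilbert spaces\<close>

text \<open>A complex Hilbert space is presented as a complete real inner product space with a compatible
  complex structure. The complex inner product is linear in its first argument.\<close>

class chilbert_space = real_inner + complete_space +
  fixes scaleC :: "complex \<Rightarrow> 'a \<Rightarrow> 'a" (infixr \<open>*\<^sub>C\<close> 75)
    and cinner :: "'a \<Rightarrow> 'a \<Rightarrow> complex"
  assumes scaleC_add_right: "a *\<^sub>C (x + y) = a *\<^sub>C x + a *\<^sub>C y"
    and scaleC_add_left: "(a + b) *\<^sub>C x = a *\<^sub>C x + b *\<^sub>C x"
    and scaleC_scaleC: "a *\<^sub>C b *\<^sub>C x = (a * b) *\<^sub>C x"
    and scaleC_one: "1 *\<^sub>C x = x"
    and scaleR_scaleC: "r *\<^sub>R x = complex_of_real r *\<^sub>C x"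
    and cinner_commute: "cinner x y = cnj (cinner y x)"
    and cinner_add_left: "cinner (x + y) z = cinner x z + cinner y z"
    and cinner_scaleC_left: "cinner (a *\<^sub>C x) y = a * cinner x y"
    and inner_eq_Re_cinner: "inner x y = Re (cinner x y)"

global_interpretation complex_vector: vector_space "scaleC :: complex \<Rightarrow> 'a \<Rightarrow> 'a::chilbert_space"
  defines csubspace = complex_vector.subspace
    and cspan = complex_vector.span
  by unfold_locales (simp_all add: scaleC_add_right scaleC_add_left scaleC_scaleC scaleC_one)

lemma cinner_add_right: "cinner x (y + z) = cinner x y + cinner x (z::'a::chilbert_space)"
  by (metis cinner_add_left cinner_commute complex_cnj_add)

lemma cinner_scaleC_right: "cinner x (a *\<^sub>C y) = cnj a * cinner x (y::'a::chilbert_space)"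
  by (metis cinner_commute cinner_scaleC_left complex_cnj_mult)

lemma cinner_self: "cinner x x = complex_of_real ((norm (x::'a::chilbert_space))\<^sup>2)"
proof -
  have "Im (cinner x x) = 0"
    using arg_cong[OF cinner_commute[of x x], of Im] by simp
  moreover have "Re (cinner x x) = (norm x)\<^sup>2"
    by (simp add: power2_norm_eq_inner inner_eq_Re_cinner)
  ultimately show ?thesis by (simp add: complex_eq_iff)
qed

lemma norm_scaleC: "norm (a *\<^sub>C x) = cmod a * norm (x::'a::chilbert_space)"
proof -
  have "complex_of_real ((norm (a *\<^sub>C x))\<^sup>2) = complex_of_real ((cmod a * norm x)\<^sup>2)"
    unfolding cinner_self[symmetric] cinner_scaleC_left cinner_scaleC_right
    by (simp add: cinner_self power_mult_distrib complex_norm_square mult.assoc mult.commute[of "cnj a"]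
        flip: of_real_power)
  then have "(norm (a *\<^sub>C x))\<^sup>2 = (cmod a * norm x)\<^sup>2"
    using of_real_eq_iff by blast
  then show ?thesis by (simp add: power2_eq_iff_nonneg)
qed

lemma norm_cinner_le: "cmod (cinner x y) \<le> norm x * norm (y::'a::chilbert_space)"
proof (cases "cinner x y = 0")
  case False
  define c where "c = cnj (sgn (cinner x y))"
  have c1: "cmod c = 1" using False by (simp add: c_def norm_sgn)
  have "c * cinner x y = complex_of_real (cmod (cinner x y))"
    using False by (simp add: c_def sgn_div_norm scaleR_conv_of_real complex_norm_square[symmetric]
        power2_eq_square mult.assoc mult.commute[of "cnj _"] divide_simps)
  then have "cmod (cinner x y) = inner (c *\<^sub>C x) y"
    by (simp add: inner_eq_Re_cinner cinner_scaleC_left)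
  also have "\<dots> \<le> norm (c *\<^sub>C x) * norm y" by (rule norm_cauchy_schwarz)
  finally show ?thesis by (simp add: norm_scaleC c1)
qed simp

instantiation complex :: chilbert_space
begin
definition scaleC_complex :: "complex \<Rightarrow> complex \<Rightarrow> complex" where "scaleC_complex = (*)"
definition cinner_complex :: "complex \<Rightarrow> complex \<Rightarrow> complex" where "cinner_complex x y = x * cnj y"
instance
  by intro_classes
    (auto simp: scaleC_complex_def cinner_complex_def algebra_simps scaleR_conv_of_real
      inner_complex_def)
end

section \<open>Square-summable families\<close>

typedef (overloaded) ('i, 'd::chilbert_space) ell2 =
  "{f :: 'i \<Rightarrow> 'd. (\<lambda>i. (norm (f i))\<^sup>2) summable_on UNIV}"
  morphisms coeff Abs_ell2
  by (rule exI[of _ "\<lambda>_. 0"]) simp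

lemma sq_norm_add_le: "(norm (a + b))\<^sup>2 \<le> 2 * (norm a)\<^sup>2 + 2 * (norm (b::'a::real_inner))\<^sup>2"
proof -
  have "(norm (a + b))\<^sup>2 \<le> (norm a + norm b)\<^sup>2"
    by (intro power_mono norm_triangle_ineq) auto
  also have "\<dots> \<le> 2 * (norm a)\<^sup>2 + 2 * (norm b)\<^sup>2"
    using sum_squares_bound[of "norm a" "norm b"] by (simp add: power2_sum)
  finally show ?thesis .
qed

lemma summable_coeff: "(\<lambda>i. (norm (coeff x i))\<^sup>2) summable_on UNIV"
  using coeff[of x] by simp

lemma ell2_add_closed:
  fixes f g :: "'i \<Rightarrow> 'd::chilbert_space"
  assumes "(\<lambda>i. (norm (f i))\<^sup>2) summable_on UNIV" "(\<lambda>i. (norm (g i))\<^sup>2) summable_on UNIV"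
  shows "(\<lambda>i. (norm (f i + g i))\<^sup>2) summable_on UNIV"
proof (rule summable_on_comparison_test)
  show "(\<lambda>i. 2 * (norm (f i))\<^sup>2 + 2 * (norm (g i))\<^sup>2) summable_on UNIV"
    by (intro summable_on_add summable_on_cmult_right assms)
qed (auto intro: sq_norm_add_le)

lemma summable_cinner:
  fixes f g :: "'i \<Rightarrow> 'd::chilbert_space"
  assumes "(\<lambda>i. (norm (f i))\<^sup>2) summable_on UNIV" "(\<lambda>i. (norm (g i))\<^sup>2) summable_on UNIV"
  shows "(\<lambda>i. cinner (f i) (g i)) summable_on UNIV"
proof (rule abs_summable_summable, rule summable_on_comparison_test)
  show "(\<lambda>i. (norm (f i))\<^sup>2 + (norm (g i))\<^sup>2) summable_on UNIV"
    by (intro summable_on_add assms)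
  fix i
  have "2 * (norm (f i) * norm (g i)) \<le> (norm (f i))\<^sup>2 + (norm (g i))\<^sup>2"
    using sum_squares_bound[of "norm (f i)" "norm (g i)"] by simp
  moreover have "0 \<le> norm (f i) * norm (g i)" by simp
  ultimately show "norm (cinner (f i) (g i)) \<le> (norm (f i))\<^sup>2 + (norm (g i))\<^sup>2"
    using norm_cinner_le[of "f i" "g i"] by linarith
qed auto

lemma summable_inner:
  fixes f g :: "'i \<Rightarrow> 'd::chilbert_space"
  assumes "(\<lambda>i. (norm (f i))\<^sup>2) summable_on UNIV" "(\<lambda>i. (norm (g i))\<^sup>2) summable_on UNIV"
  shows "(\<lambda>i. inner (f i) (g i)) summable_on UNIV"
  unfolding inner_eq_Re_cinner by (intro summable_on_Re summable_cinner assms)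

instantiation ell2 :: (type, chilbert_space) real_inner
begin
definition zero_ell2 :: "('a, 'b) ell2" where "0 = Abs_ell2 (\<lambda>_. 0)"
definition plus_ell2 :: "('a, 'b) ell2 \<Rightarrow> ('a, 'b) ell2 \<Rightarrow> ('a, 'b) ell2"
  where "x + y = Abs_ell2 (\<lambda>i. coeff x i + coeff y i)"
definition uminus_ell2 :: "('a, 'b) ell2 \<Rightarrow> ('a, 'b) ell2"
  where "- x = Abs_ell2 (\<lambda>i. - coeff x i)"
definition minus_ell2 :: "('a, 'b) ell2 \<Rightarrow> ('a, 'b) ell2 \<Rightarrow> ('a, 'b) ell2"
  where "x - y = Abs_ell2 (\<lambda>i. coeff x i - coeff y i)"
definition scaleR_ell2 :: "real \<Rightarrow> ('a, 'b) ell2 \<Rightarrow> ('a, 'b) ell2"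
  where "r *\<^sub>R x = Abs_ell2 (\<lambda>i. r *\<^sub>R coeff x i)"
definition inner_ell2 :: "('a, 'b) ell2 \<Rightarrow> ('a, 'b) ell2 \<Rightarrow> real"
  where "inner x y = (\<Sum>\<^sub>\<infinity>i. inner (coeff x i) (coeff y i))"
definition norm_ell2 :: "('a, 'b) ell2 \<Rightarrow> real" where "norm_ell2 x = sqrt (inner x x)"
definition dist_ell2 :: "('a, 'b) ell2 \<Rightarrow> ('a, 'b) ell2 \<Rightarrow> real" where "dist_ell2 x y = norm (x - y)"
definition sgn_ell2 :: "('a, 'b) ell2 \<Rightarrow> ('a, 'b) ell2" where "sgn_ell2 x = inverse (norm x) *\<^sub>R x"
definition uniformity_ell2 :: "(('a, 'b) ell2 \<times> ('a, 'b) ell2) filter"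
  where "uniformity = (INF e\<in>{0 <..}. principal {(x :: ('a, 'b) ell2, y). dist x y < e})"
definition open_ell2 :: "('a, 'b) ell2 set \<Rightarrow> bool"
  where "open_ell2 U \<longleftrightarrow> (\<forall>x\<in>U. \<forall>\<^sub>F (x', y) in uniformity. x' = x \<longrightarrow> y \<in> U)"

lemma coeff_zero [simp]: "coeff 0 i = 0"
  by (simp add: zero_ell2_def Abs_ell2_inverse)

lemma coeff_plus [simp]: "coeff (x + y) i = coeff x i + coeff y i"
  by (simp add: plus_ell2_def Abs_ell2_inverse ell2_add_closed summable_coeff)

lemma coeff_uminus [simp]: "coeff (- x) i = - coeff x i"
  by (simp add: uminus_ell2_def Abs_ell2_inverse summable_coeff)

lemma coeff_minus [simp]: "coeff (x - y) i = coeff x i - coeff y i"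
proof -
  have "(\<lambda>i. (norm (coeff x i + coeff (- y) i))\<^sup>2) summable_on UNIV"
    by (intro ell2_add_closed summable_coeff)
  then show ?thesis by (simp add: minus_ell2_def Abs_ell2_inverse)
qed

lemma coeff_scaleR [simp]: "coeff (r *\<^sub>R x) i = r *\<^sub>R coeff x i"
  by (simp add: scaleR_ell2_def Abs_ell2_inverse power_mult_distrib summable_on_cmult_right
      summable_coeff)

lemma ell2_eqI: "(\<And>i. coeff x i = coeff y i) \<Longrightarrow> x = y"
  by (metis coeff_inject ext)

lemma inner_self_ell2: "inner x x = (\<Sum>\<^sub>\<infinity>i. (norm (coeff x i))\<^sup>2)"
  for x :: "('a, 'b) ell2"
  by (simp add: inner_ell2_def power2_norm_eq_inner)

instance
proof
  fix x y z :: "('a, 'b) ell2" and a b r :: real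
  show "x + y + z = x + (y + z)" "x + y = y + x" "0 + x = x" "- x + x = 0" "x - y = x + - y"
    by (rule ell2_eqI; simp)+
  show "a *\<^sub>R (x + y) = a *\<^sub>R x + a *\<^sub>R y" "(a + b) *\<^sub>R x = a *\<^sub>R x + b *\<^sub>R x"
    "a *\<^sub>R b *\<^sub>R x = (a * b) *\<^sub>R x" "1 *\<^sub>R x = x"
    by (rule ell2_eqI; simp add: scaleR_add_right scaleR_add_left)+
  show "dist x y = norm (x - y)" "sgn x = inverse (norm x) *\<^sub>R x" "norm x = sqrt (inner x x)"
    by (simp_all add: dist_ell2_def sgn_ell2_def norm_ell2_def)
  show "uniformity = (INF e\<in>{0 <..}. principal {(x :: ('a, 'b) ell2, y). dist x y < e})"
    by (rule uniformity_ell2_def)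
  show "open U \<longleftrightarrow> (\<forall>x\<in>U. \<forall>\<^sub>F (x', y) in uniformity. x' = x \<longrightarrow> y \<in> U)" for U :: "('a, 'b) ell2 set"
    by (rule open_ell2_def)
  show "inner x y = inner y x" by (simp add: inner_ell2_def inner_commute)
  show "inner (x + y) z = inner x z + inner y z"
    unfolding inner_ell2_def coeff_plus inner_add_left
    by (intro infsum_add summable_inner summable_coeff)
  show "inner (r *\<^sub>R x) y = r * inner x y"
    unfolding inner_ell2_def coeff_scaleR inner_scaleR_left
    by (intro infsum_cmult_right summable_inner summable_coeff)
  show "0 \<le> inner x x"
    unfolding inner_self_ell2 by (intro infsum_nonneg) auto
  show "(inner x x = 0) = (x = 0)"
  proof
    assume "inner x x = 0"
    then have "(norm (coeff x i))\<^sup>2 = 0" for i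
      unfolding inner_self_ell2 by (intro nonneg_infsum_le_0D[of _ UNIV]) (auto simp: summable_coeff)
    then show "x = 0" by (intro ell2_eqI) simp
  qed (simp add: inner_self_ell2)
qed
end

lemma norm_sq_ell2: "(norm x)\<^sup>2 = (\<Sum>\<^sub>\<infinity>i. (norm (coeff x i))\<^sup>2)"
  by (simp add: power2_norm_eq_inner inner_self_ell2)

lemma sum_coeff_le: "finite F \<Longrightarrow> (\<Sum>i\<in>F. (norm (coeff x i))\<^sup>2) \<le> (norm x)\<^sup>2"
  unfolding norm_sq_ell2 by (intro finite_sum_le_infsum) (auto simp: summable_coeff)

lemma norm_coeff_le: "norm (coeff x i) \<le> norm x"
  using sum_coeff_le[of "{i}" x] by (simp add: power2_le_iff_abs_le)

instantiation ell2 :: (type, chilbert_space) chilbert_space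
begin
definition scaleC_ell2 :: "complex \<Rightarrow> ('a, 'b) ell2 \<Rightarrow> ('a, 'b) ell2"
  where "c *\<^sub>C x = Abs_ell2 (\<lambda>i. c *\<^sub>C coeff x i)"
definition cinner_ell2 :: "('a, 'b) ell2 \<Rightarrow> ('a, 'b) ell2 \<Rightarrow> complex"
  where "cinner x y = (\<Sum>\<^sub>\<infinity>i. cinner (coeff x i) (coeff y i))"

lemma coeff_scaleC [simp]: "coeff (c *\<^sub>C x) i = c *\<^sub>C coeff x i"
  by (simp add: scaleC_ell2_def Abs_ell2_inverse power_mult_distrib summable_on_cmult_right
      summable_coeff norm_scaleC)

lemma ell2_complete:
  fixes X :: "nat \<Rightarrow> ('a, 'b) ell2"
  assumes "Cauchy X"
  shows "convergent X"
proof -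
  have "Cauchy (\<lambda>n. coeff (X n) i)" for i
  proof (rule metric_CauchyI)
    fix e :: real assume "e > 0"
    then obtain M where M: "\<And>m n. m \<ge> M \<Longrightarrow> n \<ge> M \<Longrightarrow> dist (X m) (X n) < e"
      using metric_CauchyD[OF assms] by blast
    have "dist (coeff (X m) i) (coeff (X n) i) < e" if "m \<ge> M" "n \<ge> M" for m n
      using norm_coeff_le[of "X m - X n" i] M[OF that] by (simp add: dist_norm)
    then show "\<exists>M. \<forall>m\<ge>M. \<forall>n\<ge>M. dist (coeff (X m) i) (coeff (X n) i) < e" by blast
  qed
  then have "\<exists>l. (\<lambda>n. coeff (X n) i) \<longlonglongrightarrow> l" for i
    by (simp add: Cauchy_convergent_iff convergent_def)
  then obtain f where f: "\<And>i. (\<lambda>n. coeff (X n) i) \<longlonglongrightarrow> f i" by metis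
  have bound: "\<exists>M. \<forall>n\<ge>M. \<forall>F. finite F \<longrightarrow> (\<Sum>i\<in>F. (norm (f i - coeff (X n) i))\<^sup>2) \<le> e\<^sup>2"
    if "e > 0" for e :: real
  proof -
    obtain M where M: "\<And>m n. m \<ge> M \<Longrightarrow> n \<ge> M \<Longrightarrow> dist (X m) (X n) < e"
      using metric_CauchyD[OF assms \<open>e > 0\<close>] by blast
    have "(\<Sum>i\<in>F. (norm (f i - coeff (X n) i))\<^sup>2) \<le> e\<^sup>2" if "n \<ge> M" "finite F" for n F
    proof (rule LIMSEQ_le_const2)
      show "(\<lambda>m. \<Sum>i\<in>F. (norm (coeff (X m) i - coeff (X n) i))\<^sup>2) \<longlonglongrightarrow>
        (\<Sum>i\<in>F. (norm (f i - coeff (X n) i))\<^sup>2)"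
        by (intro tendsto_intros f)
      have "(\<Sum>i\<in>F. (norm (coeff (X m) i - coeff (X n) i))\<^sup>2) \<le> e\<^sup>2" if "m \<ge> M" for m
      proof -
        have "(\<Sum>i\<in>F. (norm (coeff (X m - X n) i))\<^sup>2) \<le> (norm (X m - X n))\<^sup>2"
          by (rule sum_coeff_le[OF \<open>finite F\<close>])
        also have "\<dots> \<le> e\<^sup>2"
          using M[OF that \<open>n \<ge> M\<close>] by (intro power_mono) (auto simp: dist_norm)
        finally show ?thesis by simp
      qed
      then show "\<exists>N. \<forall>m\<ge>N. (\<Sum>i\<in>F. (norm (coeff (X m) i - coeff (X n) i))\<^sup>2) \<le> e\<^sup>2" by blast
    qed
    then show ?thesis by blast
  qed
  have summ: "(\<lambda>i. (norm (f i - coeff (X n) i))\<^sup>2) summable_on UNIV"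
    if "\<forall>F. finite F \<longrightarrow> (\<Sum>i\<in>F. (norm (f i - coeff (X n) i))\<^sup>2) \<le> e\<^sup>2" for n e
    using that by (intro nonneg_bdd_above_summable_on) (auto intro!: bdd_aboveI[of _ "e\<^sup>2"])
  obtain N where "\<forall>F. finite F \<longrightarrow> (\<Sum>i\<in>F. (norm (f i - coeff (X N) i))\<^sup>2) \<le> 1\<^sup>2"
    using bound[of 1] by auto
  from ell2_add_closed[OF summ[OF this] summable_coeff[of "X N"]]
  have "(\<lambda>i. (norm (f i))\<^sup>2) summable_on UNIV" by simp
  then have L: "coeff (Abs_ell2 f) i = f i" for i
    by (simp add: Abs_ell2_inverse)
  have "X \<longlonglongrightarrow> Abs_ell2 f"
  proof (rule metric_LIMSEQ_I)
    fix r :: real assume "r > 0"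
    then obtain M where M: "\<And>n F. n \<ge> M \<Longrightarrow> finite F \<Longrightarrow>
        (\<Sum>i\<in>F. (norm (f i - coeff (X n) i))\<^sup>2) \<le> (r/2)\<^sup>2"
      using bound[of "r/2"] by auto
    have "dist (X n) (Abs_ell2 f) < r" if "n \<ge> M" for n
    proof -
      have "(norm (Abs_ell2 f - X n))\<^sup>2 \<le> (r/2)\<^sup>2"
        unfolding norm_sq_ell2
        using M[OF that] by (intro infsum_le_finite_sums summable_coeff) (auto simp: L)
      then have "norm (Abs_ell2 f - X n) \<le> r/2"
        using \<open>r > 0\<close> by (simp add: power2_le_iff_abs_le)
      then show ?thesis using \<open>r > 0\<close> by (simp add: dist_norm norm_minus_commute)
    qed
    then show "\<exists>no. \<forall>n\<ge>no. dist (X n) (Abs_ell2 f) < r" by blast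
  qed
  then show ?thesis by (auto simp: convergent_def)
qed

instance
proof
  fix x y z :: "('a, 'b) ell2" and a b :: complex and r :: real
  show "a *\<^sub>C (x + y) = a *\<^sub>C x + a *\<^sub>C y" "(a + b) *\<^sub>C x = a *\<^sub>C x + b *\<^sub>C x"
    "a *\<^sub>C b *\<^sub>C x = (a * b) *\<^sub>C x" "1 *\<^sub>C x = x" "r *\<^sub>R x = complex_of_real r *\<^sub>C x"
    by (rule ell2_eqI; simp add: scaleC_add_right scaleC_add_left scaleC_scaleC scaleC_one scaleR_scaleC)+
  show "cinner x y = cnj (cinner y x)"
    unfolding cinner_ell2_def infsum_cnj[symmetric]
    by (simp add: cinner_commute[symmetric])
  show "cinner (x + y) z = cinner x z + cinner y z"
    unfolding cinner_ell2_def coeff_plus cinner_add_left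
    by (intro infsum_add summable_cinner summable_coeff)
  show "cinner (a *\<^sub>C x) y = a * cinner x y"
    unfolding cinner_ell2_def coeff_scaleC cinner_scaleC_left
    by (intro infsum_cmult_right summable_cinner summable_coeff)
  show "inner x y = Re (cinner x y)"
    unfolding cinner_ell2_def inner_ell2_def inner_eq_Re_cinner
    by (intro infsum_Re summable_cinner summable_coeff)
qed (rule ell2_complete)
end

section \<open>Closed subspaces and operators\<close>

text \<open>Operators on a closed subspace \<open>K\<close> of a Hilbert space are represented by functions on the
  ambient type, of which only the restriction to \<open>K\<close> is meaningful. The adjoint of an operator
  on \<open>K\<close> is taken with respect to the Hilbert space \<open>K\<close>.\<close>

definition bounded_clinear_on :: "'a::chilbert_space set \<Rightarrow> ('a \<Rightarrow> 'b::chilbert_space) \<Rightarrow> bool"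
  where "bounded_clinear_on K T \<longleftrightarrow>
    (\<forall>x\<in>K. \<forall>y\<in>K. T (x + y) = T x + T y) \<and> (\<forall>c. \<forall>x\<in>K. T (c *\<^sub>C x) = c *\<^sub>C T x) \<and>
    (\<exists>C. \<forall>x\<in>K. norm (T x) \<le> C * norm x)"

definition orthogonal_complement :: "'a::chilbert_space set \<Rightarrow> 'a set"
  where "orthogonal_complement K = {x. \<forall>y\<in>K. cinner x y = 0}"

definition proj :: "'a::chilbert_space set \<Rightarrow> 'a \<Rightarrow> 'a"
  where "proj K x = (THE y. y \<in> K \<and> x - y \<in> orthogonal_complement K)"

definition adjoint_on :: "'a::chilbert_space set \<Rightarrow> ('a \<Rightarrow> 'a) \<Rightarrow> 'a \<Rightarrow> 'a"
  where "adjoint_on K T x = (THE y. y \<in> K \<and> (\<forall>z\<in>K. cinner (T z) x = cinner z y))"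

definition coinvariant :: "'a::chilbert_space set \<Rightarrow> ('a \<Rightarrow> 'a) set \<Rightarrow> 'a set \<Rightarrow> bool"
  where "coinvariant K \<T> M \<longleftrightarrow> (\<forall>T\<in>\<T>. \<forall>x\<in>M. adjoint_on K T x \<in> M)"

text \<open>The weak operator topology on the bounded operators is the initial topology for the
  matrix-coefficient maps \<open>T \<mapsto> \<langle>T x, y\<rangle>\<close>.\<close>

definition wot :: "('a::chilbert_space \<Rightarrow> 'a) topology"
  where "wot = pullback_topology {T. bounded_clinear_on UNIV T}
    (\<lambda>T. \<lambda>(x, y). cinner (T x) y) euclidean"

definition unital_subalgebra :: "('a::chilbert_space \<Rightarrow> 'a) set \<Rightarrow> bool"
  where "unital_subalgebra A \<longleftrightarrow> id \<in> A \<and>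
    (\<forall>S\<in>A. \<forall>T\<in>A. (\<lambda>x. S x + T x) \<in> A \<and> S \<circ> T \<in> A) \<and>
    (\<forall>c. \<forall>T\<in>A. (\<lambda>x. c *\<^sub>C T x) \<in> A)"

definition wot_closed_algebra :: "('a::chilbert_space \<Rightarrow> 'a) set \<Rightarrow> ('a \<Rightarrow> 'a) set"
  where "wot_closed_algebra G = \<Inter> {A. G \<subseteq> A \<and> unital_subalgebra A \<and> closedin wot A}"

definition wot_closed_ideal :: "('a::chilbert_space \<Rightarrow> 'a) set \<Rightarrow> ('a \<Rightarrow> 'a) set \<Rightarrow> bool"
  where "wot_closed_ideal A J \<longleftrightarrow> J \<subseteq> A \<and> closedin wot J \<and> (\<lambda>_. 0) \<in> J \<and>
    (\<forall>S\<in>J. \<forall>T\<in>J. (\<lambda>x. S x + T x) \<in> J) \<and> (\<forall>c. \<forall>T\<in>J. (\<lambda>x. c *\<^sub>C T x) \<in> J) \<and>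
    (\<forall>S\<in>A. \<forall>T\<in>J. S \<circ> T \<in> J \<and> T \<circ> S \<in> J)"

section \<open>Hilbert tensor products\<close>

text \<open>The space \<open>\<ell>\<^sup>2(I) \<otimes> D\<close> is realised as \<open>\<ell>\<^sup>2(I, D)\<close>. The lemmas \<open>cinner_tensor\<close> and
  \<open>tensor_total\<close> below state the two properties that characterise it as the Hilbert tensor product.\<close>

definition tensor :: "('i, complex) ell2 \<Rightarrow> 'd::chilbert_space \<Rightarrow> ('i, 'd) ell2" (infixr \<open>\<otimes>\<close> 70)
  where "x \<otimes> d = Abs_ell2 (\<lambda>i. coeff x i *\<^sub>C d)"

definition subspace_tensor ::
  "('i, complex) ell2 set \<Rightarrow> 'd::chilbert_space set \<Rightarrow> ('i, 'd) ell2 set" (infixr \<open>\<otimes>\<^sub>s\<close> 70)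
  where "K \<otimes>\<^sub>s E = closure (cspan {x \<otimes> d | x d. x \<in> K \<and> d \<in> E})"

text \<open>For an operator \<open>T\<close> on \<open>K\<close>, this is the operator \<open>T \<otimes> I\<close> on \<open>K \<otimes> D\<close>, extended by \<open>0\<close> to
  arguments outside \<open>K \<otimes> D\<close> to make it unique as a function.\<close>

definition ampliation ::
  "('i, complex) ell2 set \<Rightarrow> (('i, complex) ell2 \<Rightarrow> ('i, complex) ell2) \<Rightarrow>
    ('i, 'd::chilbert_space) ell2 \<Rightarrow> ('i, 'd) ell2"
  where "ampliation K T = (THE R. bounded_clinear_on (K \<otimes>\<^sub>s UNIV) R \<and>
    (\<forall>x\<in>K. \<forall>d. R (x \<otimes> d) = T x \<otimes> d) \<and> (\<forall>z. z \<notin> K \<otimes>\<^sub>s UNIV \<longrightarrow> R z = 0))"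

section \<open>The full Fock space\<close>

text \<open>With \<open>H\<^sub>n = \<complex>\<^sup>n\<close>, the vectors \<open>e\<^sub>w = e\<^bsub>i1\<^esub> \<otimes> \<dots> \<otimes> e\<^bsub>ik\<^esub>\<close>, where \<open>w = [i1, \<dots>, ik]\<close> ranges over the words
  of length \<open>k\<close>, form an orthonormal basis of the \<open>k\<close>-fold tensor power of \<open>H\<^sub>n\<close>, and the empty
  word gives the basis vector \<open>1\<close> of the \<open>0\<close>-fold power. The full Fock space is therefore the space
  of square-summable coefficient families indexed by all words. The type \<^typ>\<open>'n list\<close> is also the
  free monoid on the \<open>n\<close> generators.\<close>

type_synonym 'n fock = "('n list, complex) ell2"

definition vacuum :: "'n fock"
  where "vacuum = Abs_ell2 (\<lambda>w. if w = [] then 1 else 0)"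

text \<open>The vector \<open>h \<otimes> z\<close>, in which \<open>z\<close> may have coefficients in any Hilbert space; the Fock space
  itself is the case of complex coefficients.\<close>

definition left_tensor ::
  "complex ^ 'n \<Rightarrow> ('n list, 'd::chilbert_space) ell2 \<Rightarrow> ('n list, 'd) ell2"
  where "left_tensor h z = Abs_ell2 (\<lambda>w. case w of [] \<Rightarrow> 0 | j # u \<Rightarrow> (h $ j) *\<^sub>C coeff z u)"

definition left_creation :: "'n \<Rightarrow> 'n fock \<Rightarrow> 'n::finite fock"
  where "left_creation i \<phi> = left_tensor (axis i 1) \<phi>"

definition F_infty :: "('n::finite fock \<Rightarrow> 'n fock) set"
  where "F_infty = wot_closed_algebra (range left_creation)"

definition N_space :: "('n fock \<Rightarrow> 'n fock) set \<Rightarrow> 'n fock set"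
  where "N_space J = orthogonal_complement (closure (cspan {T \<phi> | T \<phi>. T \<in> J}))"

definition B_op :: "('n::finite fock \<Rightarrow> 'n fock) set \<Rightarrow> 'n \<Rightarrow> 'n fock \<Rightarrow> 'n fock"
  where "B_op J i = proj (N_space J) \<circ> left_creation i"

definition B_word :: "('n::finite fock \<Rightarrow> 'n fock) set \<Rightarrow> 'n list \<Rightarrow> 'n fock \<Rightarrow> 'n fock"
  where "B_word J \<alpha> = foldr (\<lambda>i T. B_op J i \<circ> T) \<alpha> id"

section \<open>Well-definedness\<close>

text \<open>Existence and uniqueness for the objects introduced above by definite description or by
  \<open>Abs_ell2\<close>.\<close>

lemma cinner_zero [simp]: "cinner 0 x = 0" "cinner x 0 = 0"
  for x :: "'a::chilbert_space"
  using cinner_add_left[of 0 0 x] cinner_add_right[of x 0 0] by auto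

lemma cinner_minus: "cinner (- x) y = - cinner x y" "cinner x (- y) = - cinner x y"
  for x y :: "'a::chilbert_space"
  using cinner_add_left[of x "- x" y] cinner_add_right[of x y "- y"]
  by (simp_all add: eq_neg_iff_add_eq_0 add.commute)

lemma cinner_diff: "cinner (x - y) z = cinner x z - cinner y z"
  "cinner z (x - y) = cinner z x - cinner z y"
  for x y z :: "'a::chilbert_space"
  using cinner_add_left[of x "- y" z] cinner_add_right[of z x "- y"] by (simp_all add: cinner_minus)

lemma cinner_self_eq_0 [simp]: "cinner x x = 0 \<longleftrightarrow> x = (0::'a::chilbert_space)"
  by (simp add: cinner_self)

lemma bounded_linear_cinner_left: "bounded_linear (\<lambda>x. cinner x (y::'a::chilbert_space))"
proof (rule bounded_linear_intro)
  show "norm (cinner x y) \<le> norm x * norm y" for x by (rule norm_cinner_le)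
qed (auto simp: cinner_add_left scaleR_scaleC cinner_scaleC_left scaleC_complex_def)

lemma tendsto_cinner_left: "(f \<longlongrightarrow> l) F \<Longrightarrow> ((\<lambda>x. cinner (f x) y) \<longlongrightarrow> cinner l y) F"
  for y :: "'a::chilbert_space"
  by (rule bounded_linear.tendsto[OF bounded_linear_cinner_left])

lemma bounded_linear_scaleC: "bounded_linear (\<lambda>x. c *\<^sub>C (x::'a::chilbert_space))"
proof (rule bounded_linear_intro)
  show "norm (c *\<^sub>C x) \<le> norm x * cmod c" for x :: 'a by (simp add: norm_scaleC mult.commute)
qed (auto simp: scaleC_add_right scaleR_scaleC scaleC_scaleC mult.commute)

lemma csubspace_closure:
  assumes "csubspace (K::'a::chilbert_space set)"
  shows "csubspace (closure K)"
proof -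
  have "0 \<in> closure K"
    using assms closure_subset by (auto simp: complex_vector.subspace_def)
  moreover have "x + y \<in> closure K" if xy: "x \<in> closure K" "y \<in> closure K" for x y
  proof -
    obtain f where "\<And>n. f n \<in> K" "f \<longlonglongrightarrow> x"
      using xy(1) unfolding closure_sequential by blast
    moreover obtain g where "\<And>n. g n \<in> K" "g \<longlonglongrightarrow> y"
      using xy(2) unfolding closure_sequential by blast
    ultimately have "\<And>n. f n + g n \<in> K" "(\<lambda>n. f n + g n) \<longlonglongrightarrow> x + y"
      using assms by (auto simp: complex_vector.subspace_def intro: tendsto_add)
    then show ?thesis
      unfolding closure_sequential by (intro exI[of _ "\<lambda>n. f n + g n"]) auto
  qed
  moreover have "c *\<^sub>C x \<in> closure K" if x: "x \<in> closure K" for c x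
  proof -
    obtain f where "\<And>n. f n \<in> K" "f \<longlonglongrightarrow> x"
      using x unfolding closure_sequential by blast
    then have "\<And>n. c *\<^sub>C f n \<in> K" "(\<lambda>n. c *\<^sub>C f n) \<longlonglongrightarrow> c *\<^sub>C x"
      using assms bounded_linear.tendsto[OF bounded_linear_scaleC]
      by (auto simp: complex_vector.subspace_def)
    then show ?thesis
      unfolding closure_sequential by (intro exI[of _ "\<lambda>n. c *\<^sub>C f n"]) auto
  qed
  ultimately show ?thesis by (simp add: complex_vector.subspace_def)
qed

lemma csubspace_orthogonal_complement: "csubspace (orthogonal_complement K)"
  by (auto simp: complex_vector.subspace_def orthogonal_complement_def cinner_add_left
      cinner_scaleC_left)

lemma closed_orthogonal_complement: "closed (orthogonal_complement (K::'a::chilbert_space set))"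
proof -
  have "orthogonal_complement K = (\<Inter>y\<in>K. (\<lambda>x. cinner x y) -` {0})"
    by (auto simp: orthogonal_complement_def)
  moreover have "closed ((\<lambda>x. cinner x y) -` {0})" for y :: 'a
    by (intro continuous_closed_vimage closed_singleton
        linear_continuous_at bounded_linear_cinner_left)
  ultimately show ?thesis by auto
qed

lemma proj_ex:
  fixes K :: "'a::chilbert_space set"
  assumes "csubspace K" "closed K"
  shows "\<exists>y\<in>K. x - y \<in> orthogonal_complement K"
proof -
  have K0: "0 \<in> K" and Kadd: "\<And>u v. u \<in> K \<Longrightarrow> v \<in> K \<Longrightarrow> u + v \<in> K"
    and Ksc: "\<And>c u. u \<in> K \<Longrightarrow> c *\<^sub>C u \<in> K"
    using assms(1) by (auto simp: complex_vector.subspace_def)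
  define D where "D = (\<lambda>y. (norm (x - y))\<^sup>2) ` K"
  define d where "d = Inf D"
  have bdd: "bdd_below D" by (auto simp: D_def intro!: bdd_belowI[of _ 0])
  have dle: "d \<le> (norm (x - y))\<^sup>2" if "y \<in> K" for y
    unfolding d_def by (rule cInf_lower[OF _ bdd]) (use that in \<open>auto simp: D_def\<close>)
  have "\<exists>y\<in>K. (norm (x - y))\<^sup>2 < d + 1 / real (Suc n)" for n
  proof -
    have "Inf D < d + 1 / real (Suc n)" by (simp add: d_def)
    then show ?thesis
      using cInf_lessD[of D] K0 by (auto simp: D_def)
  qed
  then obtain y where y: "\<And>n. y n \<in> K" "\<And>n. (norm (x - y n))\<^sup>2 < d + 1 / real (Suc n)"
    by metis
  have par: "(norm (u - v))\<^sup>2 \<le> 2 * ((norm (x - u))\<^sup>2 - d) + 2 * ((norm (x - v))\<^sup>2 - d)"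
    if "u \<in> K" "v \<in> K" for u v
  proof -
    have "(1/2) *\<^sub>R (u + v) \<in> K"
      unfolding scaleR_scaleC by (intro Ksc Kadd that)
    from dle[OF this] have "4 * d \<le> 4 * (norm (x - (1/2) *\<^sub>R (u + v)))\<^sup>2" by simp
    also have "\<dots> = (norm ((x - u) + (x - v)))\<^sup>2"
      unfolding power2_norm_eq_inner by (simp add: algebra_simps inner_commute)
    also have "\<dots> = 2 * (norm (x - u))\<^sup>2 + 2 * (norm (x - v))\<^sup>2 - (norm (u - v))\<^sup>2"
      unfolding power2_norm_eq_inner by (simp add: algebra_simps inner_commute)
    finally show ?thesis by simp
  qed
  have "Cauchy y"
  proof (rule metric_CauchyI)
    fix e :: real assume "e > 0"
    then obtain M where M: "1 / real (Suc M) < e\<^sup>2 / 4"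
      using reals_Archimedean[of "e\<^sup>2 / 4"] by (auto simp: inverse_eq_divide)
    have near: "(norm (x - y n))\<^sup>2 - d < e\<^sup>2 / 4" if "n \<ge> M" for n
    proof -
      have "1 / real (Suc n) \<le> 1 / real (Suc M)"
        using that by (intro divide_left_mono) auto
      then have "1 / real (Suc n) < e\<^sup>2 / 4" using M by (rule order.strict_trans1)
      then show ?thesis using y(2)[of n] by simp
    qed
    have "dist (y m) (y n) < e" if "m \<ge> M" "n \<ge> M" for m n
    proof -
      have "(norm (y m - y n))\<^sup>2 < e\<^sup>2"
        using par[OF y(1) y(1), of m n] near[OF that(1)] near[OF that(2)] by simp
      then show ?thesis using \<open>e > 0\<close> by (simp add: dist_norm power_less_imp_less_base)
    qed
    then show "\<exists>M. \<forall>m\<ge>M. \<forall>n\<ge>M. dist (y m) (y n) < e" by blast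
  qed
  then obtain l where l: "y \<longlonglongrightarrow> l"
    using Cauchy_convergent convergent_def by blast
  have lK: "l \<in> K"
    using closed_sequentially[OF assms(2) _ l] y(1) by blast
  have "(norm (x - l))\<^sup>2 \<le> d"
  proof (rule LIMSEQ_le)
    show "(\<lambda>n. (norm (x - y n))\<^sup>2) \<longlonglongrightarrow> (norm (x - l))\<^sup>2" by (intro tendsto_intros l)
    show "(\<lambda>n. d + 1 / real (Suc n)) \<longlonglongrightarrow> d"
      using tendsto_add[OF tendsto_const LIMSEQ_inverse_real_of_nat, of d]
      by (simp add: inverse_eq_divide)
    show "\<exists>N. \<forall>n\<ge>N. (norm (x - y n))\<^sup>2 \<le> d + 1 / real (Suc n)"
      using y(2) less_imp_le by blast
  qed
  then have min: "(norm (x - l))\<^sup>2 \<le> (norm (x - z))\<^sup>2" if "z \<in> K" for z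
    using dle[OF that] by linarith
  have "cinner (x - l) z = 0" if z: "z \<in> K" for z
  proof (cases "z = 0")
    case False
    define c where "c = cinner (x - l) z / complex_of_real ((norm z)\<^sup>2)"
    have e1: "cinner (x - l) z = c * complex_of_real ((norm z)\<^sup>2)"
      using False by (simp add: c_def)
    have e2: "cinner z (x - l) = cnj c * complex_of_real ((norm z)\<^sup>2)"
      by (subst cinner_commute) (simp add: e1)
    have "cinner (x - l - c *\<^sub>C z) (x - l - c *\<^sub>C z)
        = cinner (x - l) (x - l) - cnj c * c * complex_of_real ((norm z)\<^sup>2)"
      by (simp only: cinner_diff(1)[of "x - l" "c *\<^sub>C z"] cinner_diff(2)[of _ "x - l" "c *\<^sub>C z"]
          cinner_scaleC_left cinner_scaleC_right e1 e2 cinner_self[of z]) (simp add: algebra_simps)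
    then have "complex_of_real ((norm (x - (l + c *\<^sub>C z)))\<^sup>2)
        = complex_of_real ((norm (x - l))\<^sup>2) - cnj c * c * complex_of_real ((norm z)\<^sup>2)"
      unfolding cinner_self diff_diff_eq .
    also have "cnj c * c = complex_of_real ((cmod c)\<^sup>2)"
      by (simp add: complex_norm_square mult.commute del: of_real_power)
    finally have "complex_of_real ((norm (x - (l + c *\<^sub>C z)))\<^sup>2)
        = complex_of_real ((norm (x - l))\<^sup>2 - (cmod c)\<^sup>2 * (norm z)\<^sup>2)"
      by simp
    then have "(norm (x - (l + c *\<^sub>C z)))\<^sup>2 = (norm (x - l))\<^sup>2 - (cmod c)\<^sup>2 * (norm z)\<^sup>2"
      using of_real_eq_iff by blast
    moreover have "(norm (x - l))\<^sup>2 \<le> (norm (x - (l + c *\<^sub>C z)))\<^sup>2"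
      by (intro min Kadd Ksc lK z)
    ultimately have "(cmod c)\<^sup>2 * (norm z)\<^sup>2 \<le> 0" by linarith
    then have "c = 0" using False by (auto simp: mult_le_0_iff)
    then show ?thesis using False by (simp add: c_def)
  qed simp
  then show ?thesis using lK by (auto simp: orthogonal_complement_def)
qed

lemma proj_unique:
  assumes "csubspace (K::'a::chilbert_space set)" "y \<in> K" "x - y \<in> orthogonal_complement K"
    "z \<in> K" "x - z \<in> orthogonal_complement K"
  shows "y = z"
proof -
  have yz: "y - z \<in> K" using assms complex_vector.subspace_diff by blast
  have "cinner (x - z) (y - z) = 0" "cinner (x - y) (y - z) = 0"
    using assms yz by (auto simp: orthogonal_complement_def)
  then have "cinner ((x - z) - (x - y)) (y - z) = 0" unfolding cinner_diff(1)[of "x - z"] by simp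
  then show ?thesis by simp
qed

lemma proj_props:
  assumes "csubspace (K::'a::chilbert_space set)" "closed K"
  shows "proj K x \<in> K" "x - proj K x \<in> orthogonal_complement K"
proof -
  have "\<exists>!y. y \<in> K \<and> x - y \<in> orthogonal_complement K"
    using proj_ex[OF assms, of x] proj_unique[OF assms(1)] by blast
  from theI'[OF this]
  show "proj K x \<in> K" "x - proj K x \<in> orthogonal_complement K" by (auto simp: proj_def)
qed

lemma proj_eqI:
  assumes "csubspace (K::'a::chilbert_space set)" "closed K" "y \<in> K"
    "x - y \<in> orthogonal_complement K"
  shows "proj K x = y"
  using proj_unique[OF assms(1) proj_props[OF assms(1,2)] assms(3,4)] .

lemma bounded_clinear_on_proj:
  assumes "csubspace (K::'a::chilbert_space set)" "closed K"
  shows "bounded_clinear_on UNIV (proj K)"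
proof -
  note p = proj_props[OF assms] and Ks = assms(1)[unfolded complex_vector.subspace_def]
    and Os = csubspace_orthogonal_complement[of K, unfolded complex_vector.subspace_def]
  have "proj K (x + y) = proj K x + proj K y" for x y
  proof (rule proj_eqI[OF assms])
    have "x + y - (proj K x + proj K y) = (x - proj K x) + (y - proj K y)" by simp
    then show "x + y - (proj K x + proj K y) \<in> orthogonal_complement K"
      using Os p(2) by presburger
  qed (use p Ks in auto)
  moreover have "proj K (c *\<^sub>C x) = c *\<^sub>C proj K x" for c x
  proof (rule proj_eqI[OF assms])
    have "c *\<^sub>C x - c *\<^sub>C proj K x = c *\<^sub>C (x - proj K x)"
      by (simp add: complex_vector.scale_right_diff_distrib)
    then show "c *\<^sub>C x - c *\<^sub>C proj K x \<in> orthogonal_complement K"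
      using Os p(2) by presburger
  qed (use p Ks in auto)
  moreover have "norm (proj K x) \<le> 1 * norm x" for x
  proof -
    have "cinner (x - proj K x) (proj K x) = 0"
      using p[of x] by (auto simp: orthogonal_complement_def)
    then have "inner x (proj K x) = (norm (proj K x))\<^sup>2"
      by (simp add: power2_norm_eq_inner inner_eq_Re_cinner cinner_diff)
    then have "norm (proj K x) * norm (proj K x) \<le> norm x * norm (proj K x)"
      using norm_cauchy_schwarz[of x "proj K x"] by (simp add: power2_eq_square)
    then show ?thesis by (cases "proj K x = 0") auto
  qed
  ultimately show ?thesis unfolding bounded_clinear_on_def by blast
qed

lemma adjoint_on_props:
  fixes K :: "'a::chilbert_space set"
  assumes K: "csubspace K" "closed K" and T: "bounded_clinear_on K T"
  shows "adjoint_on K T x \<in> K" "\<And>z. z \<in> K \<Longrightarrow> cinner (T z) x = cinner z (adjoint_on K T x)"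
proof -
  obtain C where Tadd: "\<And>u v. u \<in> K \<Longrightarrow> v \<in> K \<Longrightarrow> T (u + v) = T u + T v"
    and Tsc: "\<And>c u. u \<in> K \<Longrightarrow> T (c *\<^sub>C u) = c *\<^sub>C T u"
    and TC: "\<And>u. u \<in> K \<Longrightarrow> norm (T u) \<le> C * norm u"
    using T unfolding bounded_clinear_on_def by blast
  have K0: "0 \<in> K" and Kadd: "\<And>u v. u \<in> K \<Longrightarrow> v \<in> K \<Longrightarrow> u + v \<in> K"
    and Ksc: "\<And>c u. u \<in> K \<Longrightarrow> c *\<^sub>C u \<in> K"
    and Kd: "\<And>u v. u \<in> K \<Longrightarrow> v \<in> K \<Longrightarrow> u - v \<in> K"
    using K(1) complex_vector.subspace_diff[OF K(1)] by (auto simp: complex_vector.subspace_def)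
  have Td: "T (u - v) = T u - T v" if "u \<in> K" "v \<in> K" for u v
    using Tadd[OF Kd[OF that] that(2)] by (simp add: eq_diff_eq)
  define K1 where "K1 = {z \<in> K. cinner (T z) x = 0}"
  have sub1: "csubspace K1"
    unfolding K1_def complex_vector.subspace_def
    using K0 Kadd Ksc Tadd Tsc Td[OF K0 K0] by (auto simp: cinner_add_left cinner_scaleC_left)
  have cl1: "closed K1"
    unfolding closed_sequential_limits
  proof (intro allI impI)
    fix f l assume f: "(\<forall>n. f n \<in> K1) \<and> f \<longlonglongrightarrow> l"
    then have lK: "l \<in> K" using closed_sequentially[OF K(2), of f l] by (auto simp: K1_def)
    have "(\<lambda>n. T (f n) - T l) \<longlonglongrightarrow> 0"
    proof (rule Lim_null_comparison)
      show "\<forall>\<^sub>F n in sequentially. norm (T (f n) - T l) \<le> C * norm (f n - l)"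
      proof (intro always_eventually allI)
        fix n
        have "f n \<in> K" using f by (auto simp: K1_def)
        then show "norm (T (f n) - T l) \<le> C * norm (f n - l)"
          using TC[OF Kd[OF _ lK]] Td[OF _ lK] by metis
      qed
      show "(\<lambda>n. C * norm (f n - l)) \<longlonglongrightarrow> 0"
        using f by (intro tendsto_mult_right_zero tendsto_norm_zero) (simp add: LIM_zero)
    qed
    then have "(\<lambda>n. cinner (T (f n) - T l) x) \<longlonglongrightarrow> cinner 0 x" by (rule tendsto_cinner_left)
    then have "(\<lambda>n. - cinner (T l) x) \<longlonglongrightarrow> 0"
      using f by (simp add: cinner_diff K1_def)
    then have "cinner (T l) x = 0" by (simp add: LIMSEQ_const_iff)
    then show "l \<in> K1" using lK by (simp add: K1_def)
  qed
  have "\<exists>y\<in>K. \<forall>z\<in>K. cinner (T z) x = cinner z y"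
  proof (cases "K1 = K")
    case True
    then show ?thesis using K0 by (intro bexI[of _ 0]) (auto simp: K1_def)
  next
    case False
    then obtain z0 where z0: "z0 \<in> K" "z0 \<notin> K1" by (auto simp: K1_def)
    define u where "u = z0 - proj K1 z0"
    have p: "proj K1 z0 \<in> K1" "u \<in> orthogonal_complement K1"
      using proj_props[OF sub1 cl1] by (auto simp: u_def)
    have uK: "u \<in> K" using z0 p(1) Kd by (auto simp: u_def K1_def)
    have u1: "u \<notin> K1"
      using z0 p(1) complex_vector.subspace_add[OF sub1 _ p(1), of u] by (auto simp: u_def)
    then have fu: "cinner (T u) x \<noteq> 0" using uK by (simp add: K1_def)
    have un: "u \<noteq> 0" using u1 sub1 by (auto simp: complex_vector.subspace_def)
    define y where "y = (cnj (cinner (T u) x) / complex_of_real ((norm u)\<^sup>2)) *\<^sub>C u"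
    have "cinner (T z) x = cinner z y" if z: "z \<in> K" for z
    proof -
      define a where "a = cinner (T z) x / cinner (T u) x"
      have "z - a *\<^sub>C u \<in> K1"
        using z uK Kd Ksc fu by (simp add: K1_def Td Tsc cinner_diff cinner_scaleC_left a_def)
      then have "cinner u (z - a *\<^sub>C u) = 0" using p(2) by (auto simp: orthogonal_complement_def)
      then have "cinner (z - a *\<^sub>C u) u = 0" by (subst cinner_commute) simp
      then have "cinner z u = a * complex_of_real ((norm u)\<^sup>2)"
        by (simp add: cinner_diff cinner_scaleC_left cinner_self)
      then show ?thesis
        using un fu by (simp add: y_def cinner_scaleC_right a_def)
    qed
    then show ?thesis using Ksc[OF uK] y_def by blast
  qed
  moreover have "y = y'" if "y \<in> K" "y' \<in> K" "\<forall>z\<in>K. cinner (T z) x = cinner z y"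
    "\<forall>z\<in>K. cinner (T z) x = cinner z y'" for y y'
  proof -
    have "cinner (y - y') (y - y') = 0"
      using that Kd[OF that(1,2)] by (metis cinner_diff(2) diff_self)
    then show ?thesis by simp
  qed
  ultimately have "\<exists>!y. y \<in> K \<and> (\<forall>z\<in>K. cinner (T z) x = cinner z y)" by blast
  from theI'[OF this]
  show "adjoint_on K T x \<in> K" "\<And>z. z \<in> K \<Longrightarrow> cinner (T z) x = cinner z (adjoint_on K T x)"
    by (auto simp: adjoint_on_def)
qed

lemma coeff_tensor [simp]: "coeff (x \<otimes> d) i = coeff x i *\<^sub>C d"
  by (simp add: tensor_def Abs_ell2_inverse norm_scaleC power_mult_distrib summable_on_cmult_left
      summable_coeff)

lemma tensor_linear:
  "(x + y) \<otimes> d = x \<otimes> d + y \<otimes> d" "x \<otimes> (d + e) = x \<otimes> d + x \<otimes> e"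
  "(c *\<^sub>C x) \<otimes> d = c *\<^sub>C (x \<otimes> d)" "x \<otimes> (c *\<^sub>C d) = c *\<^sub>C (x \<otimes> d)"
  by (rule ell2_eqI; simp add: scaleC_add_left scaleC_add_right scaleC_scaleC scaleC_complex_def
      mult.commute)+

lemma cinner_tensor: "cinner (x \<otimes> d) (y \<otimes> e) = cinner x y * cinner d e"
proof -
  have "cinner (coeff x i *\<^sub>C d) (coeff y i *\<^sub>C e) = cinner (coeff x i) (coeff y i) * cinner d e" for i
    by (simp add: cinner_scaleC_left cinner_scaleC_right cinner_complex_def)
  then show ?thesis by (simp add: cinner_ell2_def infsum_cmult_left')
qed

lemma tensor_total: "UNIV \<otimes>\<^sub>s UNIV = (UNIV :: ('i, 'd::chilbert_space) ell2 set)"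
proof -
  define K :: "('i, 'd) ell2 set" where "K = UNIV \<otimes>\<^sub>s UNIV"
  have K: "csubspace K" "closed K"
    by (auto simp: K_def subspace_tensor_def csubspace_closure)
  have tK: "x \<otimes> d \<in> K" for x d
    unfolding K_def subspace_tensor_def
    by (rule subsetD[OF closure_subset]) (auto intro: complex_vector.span_base)
  have "z = 0" if "z \<in> orthogonal_complement K" for z
  proof (rule ell2_eqI)
    fix i
    define \<delta> :: "('i, complex) ell2" where "\<delta> = Abs_ell2 (\<lambda>j. if j = i then 1 else 0)"
    have "(\<lambda>j. (norm (if j = i then 1 else 0 :: complex))\<^sup>2) summable_on UNIV"
      by (rule summable_on_cong_neutral[THEN iffD2, OF _ _ _ summable_on_finite[of "{i}"]]) auto
    then have d: "coeff \<delta> j = (if j = i then 1 else 0)" for j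
      by (simp add: \<delta>_def Abs_ell2_inverse)
    have "0 = cinner z (\<delta> \<otimes> coeff z i)" using that tK by (auto simp: orthogonal_complement_def)
    also have "\<dots> = (\<Sum>\<^sub>\<infinity>j\<in>{i}. cinner (coeff z j) (coeff z i))"
      unfolding cinner_ell2_def by (rule infsum_cong_neutral) (auto simp: d scaleC_one)
    finally show "coeff z i = coeff 0 i" by simp
  qed
  then have "x = proj K x" for x using proj_props(2)[OF K, of x] by fastforce
  then show ?thesis using proj_props(1)[OF K] by (metis K_def UNIV_eq_I)
qed

lemma has_sum_lists:
  fixes f :: "'n::finite list \<Rightarrow> 'a::{topological_comm_monoid_add, t2_space}"
  assumes "\<And>j. ((\<lambda>u. f (j # u)) has_sum s j) UNIV"
  shows "(f has_sum (f [] + (\<Sum>j\<in>UNIV. s j))) UNIV"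
proof -
  have "(f has_sum s j) ((#) j ` UNIV)" for j
    using assms[of j] by (subst has_sum_reindex) (auto simp: o_def)
  then have "(f has_sum (\<Sum>j\<in>UNIV. s j)) (\<Union>j\<in>UNIV. (#) j ` UNIV)"
    by (intro sum_has_sum) auto
  then have "(f has_sum (f [] + (\<Sum>j\<in>UNIV. s j))) ({[]} \<union> (\<Union>j\<in>UNIV. (#) j ` UNIV))"
    by (intro has_sum_Un_disjoint) (auto intro: has_sum_finiteI)
  moreover have "{[]} \<union> (\<Union>j\<in>UNIV. (#) j ` UNIV) = (UNIV :: 'n list set)"
    by (auto simp: image_iff) (metis neq_Nil_conv)
  ultimately show ?thesis by simp
qed

lemma coeff_left_tensor:
  fixes z :: "('n::finite list, 'd::chilbert_space) ell2"
  shows "coeff (left_tensor h z) w = (case w of [] \<Rightarrow> 0 | j # u \<Rightarrow> (h $ j) *\<^sub>C coeff z u)"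
proof -
  have "((\<lambda>u. (norm ((h $ j) *\<^sub>C coeff z u))\<^sup>2) has_sum ((cmod (h $ j))\<^sup>2 * (norm z)\<^sup>2)) UNIV" for j
    unfolding norm_scaleC power_mult_distrib norm_sq_ell2
    by (intro has_sum_cmult_right has_sum_infsum summable_coeff)
  then have "(\<lambda>w. (norm (case w of [] \<Rightarrow> 0 | j # u \<Rightarrow> (h $ j) *\<^sub>C coeff z u))\<^sup>2) summable_on UNIV"
    by (intro has_sum_imp_summable[OF has_sum_lists]) simp
  then show ?thesis by (simp add: left_tensor_def Abs_ell2_inverse)
qed

lemma cinner_left_tensor:
  fixes y z :: "('n::finite list, 'd::chilbert_space) ell2"
  shows "cinner (left_tensor g y) (left_tensor h z) = (\<Sum>j\<in>UNIV. g $ j * cnj (h $ j)) * cinner y z"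
proof -
  let ?f = "\<lambda>w. cinner (coeff (left_tensor g y) w) (coeff (left_tensor h z) w)"
  have "((\<lambda>u. ?f (j # u)) has_sum (g $ j * cnj (h $ j) * cinner y z)) UNIV" for j
    unfolding coeff_left_tensor list.case cinner_scaleC_left cinner_scaleC_right mult.assoc
      mult.left_commute[of "g $ j"] cinner_ell2_def
    by (intro has_sum_cmult_right has_sum_infsum summable_cinner summable_coeff)
  then have "(?f has_sum (?f [] + (\<Sum>j\<in>UNIV. g $ j * cnj (h $ j) * cinner y z))) UNIV"
    by (rule has_sum_lists)
  then show ?thesis
    by (simp add: coeff_left_tensor infsumI cinner_ell2_def[of "left_tensor g y"] sum_distrib_right)
qed

lemma bounded_clinear_on_left_tensor:
  "bounded_clinear_on UNIV (left_tensor h :: ('n::finite list, 'd::chilbert_space) ell2 \<Rightarrow> _)"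
proof -
  have "left_tensor h (y + z) = left_tensor h y + left_tensor h z"
    "left_tensor h (c *\<^sub>C z) = c *\<^sub>C left_tensor h z" for y z :: "('n list, 'd) ell2" and c
    by (rule ell2_eqI; simp add: coeff_left_tensor scaleC_add_right scaleC_scaleC mult.commute
        split: list.split)+
  moreover have "norm (left_tensor h z) \<le> sqrt (\<Sum>j\<in>UNIV. (cmod (h $ j))\<^sup>2) * norm z"
    for z :: "('n list, 'd) ell2"
  proof -
    have "complex_of_real ((norm (left_tensor h z))\<^sup>2)
        = complex_of_real ((\<Sum>j\<in>UNIV. (cmod (h $ j))\<^sup>2) * (norm z)\<^sup>2)"
      unfolding cinner_self[symmetric] cinner_left_tensor
      by (simp only: cinner_self of_real_mult of_real_sum complex_norm_square)
    then have "(norm (left_tensor h z))\<^sup>2 = (\<Sum>j\<in>UNIV. (cmod (h $ j))\<^sup>2) * (norm z)\<^sup>2"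
      using of_real_eq_iff by blast
    then have "norm (left_tensor h z) = sqrt ((\<Sum>j\<in>UNIV. (cmod (h $ j))\<^sup>2) * (norm z)\<^sup>2)"
      by (metis norm_ge_zero real_sqrt_unique)
    then show ?thesis by (simp add: real_sqrt_mult)
  qed
  ultimately show ?thesis unfolding bounded_clinear_on_def by blast
qed

lemma left_tensor_tensor: "left_tensor h (x \<otimes> d) = left_tensor h x \<otimes> d"
  for x :: "'n::finite fock"
  by (rule ell2_eqI) (simp add: coeff_left_tensor scaleC_scaleC scaleC_complex_def split: list.split)

lemma subspace_tensor_closed: "csubspace (K \<otimes>\<^sub>s E)" "closed (K \<otimes>\<^sub>s E)"
  by (auto simp: subspace_tensor_def csubspace_closure)

lemma tensor_in: "x \<in> K \<Longrightarrow> d \<in> E \<Longrightarrow> x \<otimes> d \<in> K \<otimes>\<^sub>s E"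
  unfolding subspace_tensor_def
  by (rule subsetD[OF closure_subset]) (auto intro: complex_vector.span_base)

lemma proj_tensor:
  assumes "csubspace K" "closed K"
  shows "proj (K \<otimes>\<^sub>s UNIV) (x \<otimes> d) = proj K x \<otimes> d"
proof (rule proj_eqI[OF subspace_tensor_closed])
  show "proj K x \<otimes> d \<in> K \<otimes>\<^sub>s UNIV" by (intro tensor_in proj_props assms) simp
  let ?v = "x \<otimes> d - proj K x \<otimes> d"
  have v: "?v = (x - proj K x) \<otimes> d"
    using tensor_linear(1)[of "x - proj K x" "proj K x" d] by simp
  let ?C = "orthogonal_complement {?v}"
  have "{x \<otimes> d | x d. x \<in> K \<and> d \<in> UNIV} \<subseteq> ?C"
  proof clarsimp
    fix y and e :: 'b
    assume "y \<in> K"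
    then have "cinner (x - proj K x) y = 0"
      using proj_props(2)[OF assms] by (auto simp: orthogonal_complement_def)
    then have "cinner y (x - proj K x) = 0" by (subst cinner_commute) simp
    then show "y \<otimes> e \<in> ?C" by (simp add: orthogonal_complement_def v cinner_tensor)
  qed
  then have "K \<otimes>\<^sub>s UNIV \<subseteq> ?C"
    unfolding subspace_tensor_def
    by (intro closure_minimal complex_vector.span_minimal closed_orthogonal_complement
        csubspace_orthogonal_complement)
  then have "cinner z ?v = 0" if "z \<in> K \<otimes>\<^sub>s UNIV" for z
    using that by (auto simp: orthogonal_complement_def)
  then have "cinner ?v z = 0" if "z \<in> K \<otimes>\<^sub>s UNIV" for z
    using that by (subst cinner_commute) simp
  then show "?v \<in> orthogonal_complement (K \<otimes>\<^sub>s UNIV)" by (simp add: orthogonal_complement_def)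
qed

lemma ampliation_unique:
  fixes R R' :: "('i, 'd::chilbert_space) ell2 \<Rightarrow> ('i, 'd) ell2"
  assumes R: "bounded_clinear_on (K \<otimes>\<^sub>s UNIV) R" and R': "bounded_clinear_on (K \<otimes>\<^sub>s UNIV) R'"
    and eq: "\<And>x d. x \<in> K \<Longrightarrow> R (x \<otimes> d) = R' (x \<otimes> d)" and z: "z \<in> K \<otimes>\<^sub>s UNIV"
  shows "R z = R' z"
proof -
  let ?Kt = "K \<otimes>\<^sub>s UNIV :: ('i, 'd) ell2 set"
  let ?G = "{x \<otimes> d | x d. x \<in> K \<and> d \<in> (UNIV :: 'd set)}"
  have Ks: "0 \<in> ?Kt" "\<And>u v. u \<in> ?Kt \<Longrightarrow> v \<in> ?Kt \<Longrightarrow> u + v \<in> ?Kt"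
    "\<And>c u. u \<in> ?Kt \<Longrightarrow> c *\<^sub>C u \<in> ?Kt" "\<And>u v. u \<in> ?Kt \<Longrightarrow> v \<in> ?Kt \<Longrightarrow> u - v \<in> ?Kt"
    using subspace_tensor_closed(1)[of K "UNIV :: 'd set"] complex_vector.subspace_diff
    by (auto simp: complex_vector.subspace_def)
  have lim: "(\<lambda>n. S (f n)) \<longlonglongrightarrow> S z"
    if S: "bounded_clinear_on ?Kt S" and f: "\<And>n. f n \<in> ?Kt" "f \<longlonglongrightarrow> z"
    for S :: "('i, 'd) ell2 \<Rightarrow> ('i, 'd) ell2" and f
  proof -
    obtain C where add: "\<And>u v. u \<in> ?Kt \<Longrightarrow> v \<in> ?Kt \<Longrightarrow> S (u + v) = S u + S v"
      and C: "\<And>u. u \<in> ?Kt \<Longrightarrow> norm (S u) \<le> C * norm u"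
      using S unfolding bounded_clinear_on_def by blast
    have "norm (S (f n) - S z) \<le> C * norm (f n - z)" for n
      using add[OF Ks(4)[OF f(1)[of n] z] z] C[OF Ks(4)[OF f(1)[of n] z]] by simp
    moreover have "(\<lambda>n. C * norm (f n - z)) \<longlonglongrightarrow> 0"
      using f(2) by (intro tendsto_mult_right_zero tendsto_norm_zero) (simp add: LIM_zero)
    ultimately have "(\<lambda>n. S (f n) - S z) \<longlonglongrightarrow> 0"
      by (rule Lim_null_comparison[OF always_eventually[OF allI]])
    then show ?thesis by (simp add: LIM_zero_iff)
  qed
  have lin: "S 0 = 0 \<and> (\<forall>u\<in>?Kt. \<forall>v\<in>?Kt. S (u + v) = S u + S v) \<and> (\<forall>c. \<forall>u\<in>?Kt. S (c *\<^sub>C u) = c *\<^sub>C S u)"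
    if S: "bounded_clinear_on ?Kt S" for S :: "('i, 'd) ell2 \<Rightarrow> ('i, 'd) ell2"
  proof -
    have "S (0 + 0) = S 0 + S 0" using S Ks(1) unfolding bounded_clinear_on_def by blast
    then show ?thesis using S unfolding bounded_clinear_on_def by simp
  qed
  have "csubspace {u \<in> ?Kt. R u = R' u}"
    using lin[OF R] lin[OF R'] Ks by (auto simp: complex_vector.subspace_def)
  moreover have "?G \<subseteq> {u \<in> ?Kt. R u = R' u}" using eq by (auto intro: tensor_in)
  ultimately have sp: "cspan ?G \<subseteq> {u \<in> ?Kt. R u = R' u}"
    by (intro complex_vector.span_minimal)
  have "\<exists>f. (\<forall>n. f n \<in> cspan ?G) \<and> f \<longlonglongrightarrow> z"
    using z unfolding subspace_tensor_def closure_sequential .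
  then obtain f where f: "\<And>n. f n \<in> cspan ?G" "f \<longlonglongrightarrow> z" by blast
  then have f': "f n \<in> ?Kt" "R (f n) = R' (f n)" for n using sp by auto
  show ?thesis
    using LIMSEQ_unique[OF lim[OF R f'(1) f(2)]] lim[OF R' f'(1) f(2)] f'(2) by simp
qed

lemma ampliation_props:
  fixes R :: "('i, 'd::chilbert_space) ell2 \<Rightarrow> ('i, 'd) ell2"
  assumes R: "bounded_clinear_on (K \<otimes>\<^sub>s UNIV) R" "\<And>x d. x \<in> K \<Longrightarrow> R (x \<otimes> d) = T x \<otimes> d"
  shows "bounded_clinear_on (K \<otimes>\<^sub>s UNIV) (ampliation K T :: ('i, 'd) ell2 \<Rightarrow> _)"
    and "\<And>x d. x \<in> K \<Longrightarrow> ampliation K T (x \<otimes> d) = T x \<otimes> (d :: 'd)"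
    and "\<And>z. z \<in> K \<otimes>\<^sub>s UNIV \<Longrightarrow> ampliation K T z = R z"
proof -
  define R0 where "R0 z = (if z \<in> K \<otimes>\<^sub>s UNIV then R z else 0)" for z
  let ?P = "\<lambda>R :: ('i, 'd) ell2 \<Rightarrow> ('i, 'd) ell2. bounded_clinear_on (K \<otimes>\<^sub>s UNIV) R \<and>
    (\<forall>x\<in>K. \<forall>d. R (x \<otimes> d) = T x \<otimes> d) \<and> (\<forall>z. z \<notin> K \<otimes>\<^sub>s UNIV \<longrightarrow> R z = 0)"
  have "bounded_clinear_on (K \<otimes>\<^sub>s UNIV) R0"
    using R(1) subspace_tensor_closed(1)[of K "UNIV :: 'd set"]
    by (simp add: bounded_clinear_on_def R0_def complex_vector.subspace_def)
  then have P0: "?P R0" using R(2) by (auto simp: R0_def tensor_in)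
  moreover have "S = R0" if "?P S" for S
    using that P0 ampliation_unique[of K S R0] by (metis (lifting) ext)
  ultimately have "ampliation K T = R0" unfolding ampliation_def by (rule the_equality)
  then show "bounded_clinear_on (K \<otimes>\<^sub>s UNIV) (ampliation K T :: ('i, 'd) ell2 \<Rightarrow> _)"
    "\<And>x d. x \<in> K \<Longrightarrow> ampliation K T (x \<otimes> d) = T x \<otimes> (d :: 'd)"
    "\<And>z. z \<in> K \<otimes>\<^sub>s UNIV \<Longrightarrow> ampliation K T z = R z"
    using P0 by (auto simp: R0_def)
qed

lemma N_space_closed: "csubspace (N_space J)" "closed (N_space J)"
  by (auto simp: N_space_def csubspace_orthogonal_complement closed_orthogonal_complement)

lemma ampliation_B_op_ex:
  fixes J :: "('n::finite fock \<Rightarrow> 'n fock) set"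
  defines "Kt \<equiv> N_space J \<otimes>\<^sub>s UNIV :: ('n list, 'd::chilbert_space) ell2 set"
  shows "\<exists>R. bounded_clinear_on Kt R \<and> (\<forall>z\<in>Kt. R z \<in> Kt) \<and>
    (\<forall>x\<in>N_space J. \<forall>d. R (x \<otimes> d) = B_op J i x \<otimes> d)"
proof (intro exI conjI ballI allI)
  let ?R = "\<lambda>z. proj Kt (left_tensor (axis i 1) z)"
  have Kt: "csubspace Kt" "closed Kt" unfolding Kt_def by (rule subspace_tensor_closed)+
  obtain C where C: "\<And>x. norm (left_tensor (axis i 1) x :: ('n list, 'd) ell2) \<le> C * norm x"
    using bounded_clinear_on_left_tensor[of "axis i 1"] unfolding bounded_clinear_on_def by blast
  obtain C' where C': "\<And>x. norm (proj Kt x) \<le> C' * norm x"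
    using bounded_clinear_on_proj[OF Kt] unfolding bounded_clinear_on_def by blast
  have "norm (?R x) \<le> (\<bar>C'\<bar> * C) * norm x" for x
  proof -
    have "norm (?R x) \<le> \<bar>C'\<bar> * norm (left_tensor (axis i 1) x)"
      using C'[of "left_tensor (axis i 1) x"] by (rule order.trans) (simp add: mult_right_mono)
    also have "\<dots> \<le> \<bar>C'\<bar> * (C * norm x)" by (intro mult_left_mono C) simp
    finally show ?thesis by (simp add: mult.assoc)
  qed
  then show "bounded_clinear_on Kt ?R"
    using bounded_clinear_on_proj[OF Kt] bounded_clinear_on_left_tensor[of "axis i 1"]
    unfolding bounded_clinear_on_def by (metis UNIV_I)
  show "?R z \<in> Kt" for z by (rule proj_props[OF Kt])
  show "?R (x \<otimes> d) = B_op J i x \<otimes> d" for x d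
    by (simp add: Kt_def left_tensor_tensor proj_tensor N_space_closed B_op_def left_creation_def)
qed

lemma ampliation_B_word_ex:
  fixes J :: "('n::finite fock \<Rightarrow> 'n fock) set"
  defines "Kt \<equiv> N_space J \<otimes>\<^sub>s UNIV :: ('n list, 'd::chilbert_space) ell2 set"
  shows "\<exists>R. bounded_clinear_on Kt R \<and> (\<forall>z\<in>Kt. R z \<in> Kt) \<and>
    (\<forall>x\<in>N_space J. \<forall>d. R (x \<otimes> d) = B_word J \<alpha> x \<otimes> d \<and> B_word J \<alpha> x \<in> N_space J)"
proof (induction \<alpha>)
  case Nil
  show ?case
    by (rule exI[of _ id]) (auto simp: B_word_def bounded_clinear_on_def intro!: exI[of _ 1])
next
  case (Cons i \<alpha>)
  obtain S where S: "bounded_clinear_on Kt S" "\<And>z. z \<in> Kt \<Longrightarrow> S z \<in> Kt"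
    "\<And>x d. x \<in> N_space J \<Longrightarrow> S (x \<otimes> d) = B_word J \<alpha> x \<otimes> d"
    "\<And>x. x \<in> N_space J \<Longrightarrow> B_word J \<alpha> x \<in> N_space J"
    using Cons.IH by blast
  obtain R where R: "bounded_clinear_on Kt R" "\<And>z. z \<in> Kt \<Longrightarrow> R z \<in> Kt"
    "\<And>x d. x \<in> N_space J \<Longrightarrow> R (x \<otimes> d) = B_op J i x \<otimes> d"
    using ampliation_B_op_ex[where ?'d = 'd, of J i] unfolding Kt_def by blast
  obtain C where C: "\<And>x. x \<in> Kt \<Longrightarrow> norm (S x) \<le> C * norm x"
    using S(1) unfolding bounded_clinear_on_def by blast
  obtain C' where C': "\<And>x. x \<in> Kt \<Longrightarrow> norm (R x) \<le> C' * norm x"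
    using R(1) unfolding bounded_clinear_on_def by blast
  have "norm (R (S x)) \<le> (\<bar>C'\<bar> * C) * norm x" if "x \<in> Kt" for x
  proof -
    have "norm (R (S x)) \<le> \<bar>C'\<bar> * norm (S x)"
      using C'[OF S(2)[OF that]] by (rule order.trans) (simp add: mult_right_mono)
    also have "\<dots> \<le> \<bar>C'\<bar> * (C * norm x)" by (intro mult_left_mono C that) simp
    finally show ?thesis by (simp add: mult.assoc)
  qed
  then have "bounded_clinear_on Kt (\<lambda>z. R (S z))"
    using R(1) S(1,2) unfolding bounded_clinear_on_def by metis
  moreover have "B_op J i x \<in> N_space J" for x
    by (simp add: B_op_def proj_props N_space_closed)
  ultimately show ?case
    using R S by (intro exI[of _ "\<lambda>z. R (S z)"]) (simp add: B_word_def)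
qed

lemma coeff_vacuum: "coeff (vacuum :: 'n fock) w = (if w = [] then 1 else 0)"
proof -
  have "(\<lambda>w :: 'n list. (norm (if w = [] then 1 else 0 :: complex))\<^sup>2) summable_on UNIV"
    by (rule summable_on_cong_neutral[THEN iffD2, OF _ _ _ summable_on_finite[of "{[]}"]]) auto
  then have "coeff (vacuum :: 'n fock) = (\<lambda>w. if w = [] then 1 else 0)"
    unfolding vacuum_def by (intro Abs_ell2_inverse) blast
  then show ?thesis by simp
qed

end

theory Submission
  imports Defs
begin

text \<open>The subspace \<open>E\<close> is the closure of the set of vacuum coefficients of elements of \<open>M\<close>. Since
  \<open>N_space J\<close> is co-invariant under the creation operators and contains the vacuum, compressing
  \<open>I = P\<^sub>\<complex> + \<Sum>\<^sub>i S\<^sub>i S\<^sub>i\<^sup>*\<close> gives \<open>1 \<otimes> coeff z [] = z - \<Sum>\<^sub>i (B\<^sub>i \<otimes> I) (B\<^sub>i\<^sup>* \<otimes> I) z\<close>. For \<open>z \<in> M\<close> the right-hand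
  side lies in the span of the translates of \<open>M\<close>, and applying \<open>B\<^sub>\<alpha> \<otimes> I\<close> to it yields
  \<open>P\<^sub>N e\<^sub>\<alpha> \<otimes> coeff z []\<close>; these vectors generate \<open>N \<otimes> E\<close>. Conversely \<open>B\<^sub>i\<^sup>* \<otimes> I\<close> shifts coefficients, so
  all coefficients of elements of \<open>M\<close> lie in \<open>E\<close>, whence \<open>M \<subseteq> N \<otimes> E\<close>.\<close>

section \<open>Closed subspaces and bounded operators\<close>

lemma bounded_clinear_on_imp_bounded_linear:
  assumes "bounded_clinear_on UNIV f"
  shows "bounded_linear f"
proof -
  obtain C where C: "\<And>x. norm (f x) \<le> C * norm x"
    using assms unfolding bounded_clinear_on_def by blast
  show ?thesis
    using assms C by (intro bounded_linear_intro[of f C])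
      (auto simp: bounded_clinear_on_def scaleR_scaleC mult.commute)
qed

lemma bounded_clinear_on_compose:
  assumes "bounded_clinear_on K f" "bounded_clinear_on L g" "\<And>x. x \<in> K \<Longrightarrow> f x \<in> L"
  shows "bounded_clinear_on K (\<lambda>x. g (f x))"
proof -
  obtain C where C: "\<And>x. x \<in> K \<Longrightarrow> norm (f x) \<le> C * norm x"
    using assms(1) unfolding bounded_clinear_on_def by blast
  obtain C' where C': "\<And>x. x \<in> L \<Longrightarrow> norm (g x) \<le> C' * norm x"
    using assms(2) unfolding bounded_clinear_on_def by blast
  have "norm (g (f x)) \<le> (\<bar>C'\<bar> * C) * norm x" if "x \<in> K" for x
  proof -
    have "norm (g (f x)) \<le> \<bar>C'\<bar> * norm (f x)"
      using C'[OF assms(3)[OF that]] by (rule order.trans) (simp add: mult_right_mono)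
    also have "\<dots> \<le> \<bar>C'\<bar> * (C * norm x)" by (intro mult_left_mono C that) simp
    finally show ?thesis by (simp add: mult.assoc)
  qed
  then show ?thesis
    using assms unfolding bounded_clinear_on_def by metis
qed

lemma bounded_clinear_on_sum:
  assumes "bounded_clinear_on K R" "csubspace K" "\<And>i. i \<in> A \<Longrightarrow> f i \<in> K"
  shows "R (\<Sum>i\<in>A. f i) = (\<Sum>i\<in>A. R (f i))"
proof -
  have "0 \<in> K" using assms(2) by (rule complex_vector.subspace_0)
  then have "R (0 + 0) = R 0 + R 0" using assms(1) unfolding bounded_clinear_on_def by blast
  then have R0: "R 0 = 0" by simp
  show ?thesis
    using assms(3)
  proof (induction A rule: infinite_finite_induct)
    case (insert i A)
    then have "(\<Sum>i\<in>A. f i) \<in> K" by (intro complex_vector.subspace_sum assms(2)) auto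
    with insert assms(1) show ?case by (simp add: bounded_clinear_on_def)
  qed (simp_all add: R0)
qed

text \<open>This replaces approximation arguments below: to see that \<open>f\<close> maps a closed
  span into \<open>K\<close>, it is enough to test generators, because the preimage of
  \<open>K\<close> is again a closed subspace.\<close>

lemma csubspace_closed_vimage:
  assumes f: "bounded_clinear_on UNIV f" and K: "csubspace K" "closed K"
  shows "csubspace (f -` K)" "closed (f -` K)"
proof -
  interpret bounded_linear f by (rule bounded_clinear_on_imp_bounded_linear[OF f])
  show "csubspace (f -` K)"
    using f K(1) by (auto simp: bounded_clinear_on_def complex_vector.subspace_def zero)
  show "closed (f -` K)"
    by (intro continuous_closed_vimage K(2) linear_continuous_at bounded_linear_axioms)
qed

lemma cinner_eq_0_commute: "cinner x y = 0 \<longleftrightarrow> cinner y x = 0"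
  for x y :: "'a::chilbert_space"
  using cinner_commute[of x y] cinner_commute[of y x] by auto

lemma orthogonal_complementD: "x \<in> orthogonal_complement K \<Longrightarrow> y \<in> K \<Longrightarrow> cinner x y = 0"
  by (simp add: orthogonal_complement_def)

text \<open>Membership in \<open>N_space J\<close> can thus be tested on the vectors
  \<open>T \<phi>\<close> alone: the vectors orthogonal to a fixed \<open>x\<close> form a closed
  subspace.\<close>

lemma orthogonal_complement_closure_cspan:
  "orthogonal_complement (closure (cspan G)) = orthogonal_complement G"
proof
  have "G \<subseteq> closure (cspan G)"
    using complex_vector.span_superset closure_subset by (rule order.trans)
  then show "orthogonal_complement (closure (cspan G)) \<subseteq> orthogonal_complement G"
    by (auto simp: orthogonal_complement_def)
  have "closure (cspan G) \<subseteq> orthogonal_complement {x}" if "x \<in> orthogonal_complement G" for x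
    using that
    by (intro closure_minimal complex_vector.span_minimal closed_orthogonal_complement
        csubspace_orthogonal_complement) (auto simp: orthogonal_complement_def cinner_eq_0_commute)
  then show "orthogonal_complement G \<subseteq> orthogonal_complement (closure (cspan G))"
    by (fastforce simp: orthogonal_complement_def cinner_eq_0_commute)
qed

lemma cinner_proj_left:
  assumes "csubspace K" "closed K" "y \<in> K"
  shows "cinner (proj K x) y = cinner x y"
  using proj_props(2)[OF assms(1,2), of x] assms(3)
  by (simp add: orthogonal_complement_def cinner_diff)

lemma proj_ident:
  assumes "csubspace K" "closed K" "x \<in> K"
  shows "proj K x = x"
  using assms by (intro proj_eqI) (auto simp: orthogonal_complement_def)

lemma proj_eq_projI:
  assumes "csubspace K" "closed K" "x - y \<in> orthogonal_complement K"
  shows "proj K x = proj K y"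
proof (rule proj_eqI[OF assms(1,2) proj_props(1)[OF assms(1,2)]])
  have "x - proj K y = (x - y) + (y - proj K y)" by simp
  then show "x - proj K y \<in> orthogonal_complement K"
    using complex_vector.subspace_add[OF csubspace_orthogonal_complement assms(3)
        proj_props(2)[OF assms(1,2), of y]] by metis
qed

lemma adjoint_on_eqI:
  assumes "csubspace K" "y \<in> K" "\<And>z. z \<in> K \<Longrightarrow> cinner (T z) x = cinner z y"
  shows "adjoint_on K T x = y"
  unfolding adjoint_on_def
proof (rule the_equality)
  fix y' assume y': "y' \<in> K \<and> (\<forall>z\<in>K. cinner (T z) x = cinner z y')"
  then have "y' - y \<in> K" using assms(1,2) complex_vector.subspace_diff by blast
  then have "cinner (y' - y) (y' - y) = 0"
    using y' assms(3) by (metis cinner_diff(2) diff_self)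
  then show "y' = y" by simp
qed (use assms in auto)

section \<open>Tensor products\<close>

lemma norm_tensor: "norm (x \<otimes> d) = norm x * norm d"
proof -
  have "complex_of_real ((norm (x \<otimes> d))\<^sup>2) = complex_of_real ((norm x * norm d)\<^sup>2)"
    unfolding cinner_self[symmetric] cinner_tensor by (simp add: cinner_self power_mult_distrib)
  then have "(norm (x \<otimes> d))\<^sup>2 = (norm x * norm d)\<^sup>2"
    using of_real_eq_iff by blast
  then show ?thesis by (simp add: power2_eq_iff_nonneg)
qed

lemma bounded_clinear_on_tensor_left: "bounded_clinear_on UNIV (\<lambda>x. x \<otimes> d)"
  unfolding bounded_clinear_on_def
  by (auto simp: tensor_linear norm_tensor mult.commute intro!: exI[of _ "norm d"])

lemma bounded_clinear_on_tensor_right: "bounded_clinear_on UNIV (\<lambda>d. x \<otimes> d)"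
  unfolding bounded_clinear_on_def
  by (auto simp: tensor_linear norm_tensor intro!: exI[of _ "norm x"])

lemma subspace_tensor_least:
  assumes "csubspace L" "closed L" "\<And>x d. x \<in> K \<Longrightarrow> d \<in> E \<Longrightarrow> x \<otimes> d \<in> L"
  shows "K \<otimes>\<^sub>s E \<subseteq> L"
  unfolding subspace_tensor_def
  using assms by (intro closure_minimal complex_vector.span_minimal) auto

lemma subspace_tensor_mono: "K \<subseteq> K' \<Longrightarrow> E \<subseteq> E' \<Longrightarrow> K \<otimes>\<^sub>s E \<subseteq> K' \<otimes>\<^sub>s E'"
  by (intro subspace_tensor_least subspace_tensor_closed tensor_in) auto

section \<open>Basis vectors and coefficients\<close>

definition ket :: "'i \<Rightarrow> ('i, complex) ell2"
  where "ket i = Abs_ell2 (\<lambda>j. if j = i then 1 else 0)"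

lemma coeff_ket: "coeff (ket i) j = (if j = i then 1 else 0)"
proof -
  have "(\<lambda>j. (norm (if j = i then 1 else 0 :: complex))\<^sup>2) summable_on UNIV"
    by (rule summable_on_cong_neutral[THEN iffD2, OF _ _ _ summable_on_finite[of "{i}"]]) auto
  then show ?thesis by (simp add: ket_def Abs_ell2_inverse)
qed

lemma vacuum_eq_ket: "vacuum = ket []"
  by (rule ell2_eqI) (simp add: coeff_vacuum coeff_ket)

text \<open>In other words, \<open>d \<mapsto> ket i \<otimes> d\<close> is the adjoint of taking
  the coefficient at \<open>i\<close>.\<close>

lemma cinner_ket_tensor: "cinner z (ket i \<otimes> d) = cinner (coeff z i) d"
proof -
  have "cinner z (ket i \<otimes> d) = (\<Sum>\<^sub>\<infinity>j\<in>{i}. cinner (coeff z j) d)"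
    unfolding cinner_ell2_def
    by (rule infsum_cong_neutral) (auto simp: coeff_ket scaleC_one)
  then show ?thesis by simp
qed

text \<open>Instead of summing the components of \<open>z\<close>, one looks at the residual
  \<open>y = z - proj K z\<close>. It is orthogonal to every component, so \<open>cinner y z\<close>
  is a sum of zeros; being orthogonal to \<open>proj K z\<close> as well, it vanishes.\<close>

lemma ell2_in_closed_csubspace:
  assumes K: "csubspace K" "closed K" and z: "\<And>i. ket i \<otimes> coeff z i \<in> K"
  shows "z \<in> K"
proof -
  define y where "y = z - proj K z"
  have y: "y \<in> orthogonal_complement K" unfolding y_def by (rule proj_props(2)[OF K])
  then have "cinner (coeff y i) (coeff z i) = 0" for i
    using z by (simp add: orthogonal_complement_def flip: cinner_ket_tensor)
  then have "cinner y z = 0" by (simp add: cinner_ell2_def)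
  moreover have "cinner y (proj K z) = 0"
    using y proj_props(1)[OF K] by (auto simp: orthogonal_complement_def)
  ultimately have "cinner y y = 0" by (simp add: y_def cinner_diff(2)[of _ z])
  then have "z = proj K z" by (simp add: y_def)
  then show ?thesis using proj_props(1)[OF K] by metis
qed

lemma closed_csubspace_eq_UNIV:
  fixes K :: "('i, complex) ell2 set"
  assumes K: "csubspace K" "closed K" and ket: "\<And>i. ket i \<in> K"
  shows "K = UNIV"
proof -
  have "ket i \<otimes> c = c *\<^sub>C ket i" for i :: 'i and c :: complex
    by (rule ell2_eqI) (simp add: scaleC_complex_def)
  then have "ket i \<otimes> coeff z i \<in> K" for z i
    using complex_vector.subspace_scale[OF K(1) ket] by metis
  then have "z \<in> K" for z by (rule ell2_in_closed_csubspace[OF K])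
  then show ?thesis by blast
qed

text \<open>The components \<open>ket i \<otimes> coeff z i\<close> need not lie in
  \<open>K \<otimes>\<^sub>s E\<close>, but their projections
  \<open>proj K (ket i) \<otimes> coeff z i\<close> do. Hence the componentwise criterion is applied
  to the preimage of \<open>K \<otimes>\<^sub>s E\<close> under the projection, which fixes
  \<open>z\<close>.\<close>

lemma in_subspace_tensorI:
  assumes K: "csubspace K" "closed K" and z: "z \<in> K \<otimes>\<^sub>s UNIV" "\<And>i. coeff z i \<in> E"
  shows "z \<in> K \<otimes>\<^sub>s E"
proof -
  let ?P = "proj (K \<otimes>\<^sub>s UNIV)"
  have "z \<in> ?P -` (K \<otimes>\<^sub>s E)"
    using csubspace_closed_vimage[OF bounded_clinear_on_proj[OF subspace_tensor_closed]
        subspace_tensor_closed]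
    by (rule ell2_in_closed_csubspace) (simp add: proj_tensor K z tensor_in proj_props)
  then show ?thesis by (simp add: proj_ident subspace_tensor_closed z)
qed

section \<open>Creation operators and their adjoints\<close>

text \<open>This is the adjoint of the amplified creation operator: it strips a leading letter
  \<open>i\<close>.\<close>

definition left_annihilation ::
  "'n \<Rightarrow> ('n list, 'd::chilbert_space) ell2 \<Rightarrow> ('n list, 'd) ell2"
  where "left_annihilation i z = Abs_ell2 (\<lambda>w. coeff z (i # w))"

lemma coeff_left_annihilation [simp]: "coeff (left_annihilation i z) w = coeff z (i # w)"
proof -
  have "(\<lambda>w. (norm (coeff z w))\<^sup>2) summable_on range ((#) i)"
    using summable_coeff by (rule summable_on_subset) simp
  then have "(\<lambda>w. (norm (coeff z (i # w)))\<^sup>2) summable_on UNIV"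
    by (subst (asm) summable_on_reindex) (auto simp: o_def)
  then show ?thesis by (simp add: left_annihilation_def Abs_ell2_inverse)
qed

lemma norm_left_annihilation_le: "norm (left_annihilation i z) \<le> norm z"
proof -
  have "(norm (left_annihilation i z))\<^sup>2 \<le> (norm z)\<^sup>2"
    unfolding norm_sq_ell2[of "left_annihilation i z"]
  proof (rule infsum_le_finite_sums[OF summable_coeff])
    fix F :: "'a list set" assume F: "finite F"
    have "(\<Sum>w\<in>F. (norm (coeff (left_annihilation i z) w))\<^sup>2)
        = (\<Sum>w\<in>(#) i ` F. (norm (coeff z w))\<^sup>2)"
      by (subst sum.reindex) auto
    also have "\<dots> \<le> (norm z)\<^sup>2" using F by (intro sum_coeff_le) simp
    finally show "(\<Sum>w\<in>F. (norm (coeff (left_annihilation i z) w))\<^sup>2) \<le> (norm z)\<^sup>2" .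
  qed
  then show ?thesis by (simp add: power2_le_iff_abs_le)
qed

lemma bounded_clinear_on_left_annihilation: "bounded_clinear_on UNIV (left_annihilation i)"
  unfolding bounded_clinear_on_def
  by (auto intro!: ell2_eqI exI[of _ 1] simp: norm_left_annihilation_le)

lemma left_annihilation_tensor: "left_annihilation i (x \<otimes> d) = left_annihilation i x \<otimes> d"
  by (rule ell2_eqI) simp

text \<open>Splitting the sum over words by first letter, only the words beginning with
  \<open>i\<close> contribute.\<close>

lemma cinner_left_tensor_axis:
  fixes u z :: "('n::finite list, 'd::chilbert_space) ell2"
  shows "cinner (left_tensor (axis i 1) u) z = cinner u (left_annihilation i z)"
proof -
  let ?f = "\<lambda>w. cinner (coeff (left_tensor (axis i 1) u) w) (coeff z w)"
  have "((\<lambda>w. ?f (j # w)) has_sum (if j = i then cinner u (left_annihilation i z) else 0)) UNIV"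
    for j
  proof (cases "j = i")
    case True
    have "((\<lambda>w. cinner (coeff u w) (coeff (left_annihilation i z) w)) has_sum
        cinner u (left_annihilation i z)) UNIV"
      unfolding cinner_ell2_def by (intro has_sum_infsum summable_cinner summable_coeff)
    then show ?thesis using True by (simp add: coeff_left_tensor axis_def scaleC_one)
  qed (simp add: coeff_left_tensor axis_def)
  then have "(?f has_sum (?f [] + (\<Sum>j\<in>UNIV. if j = i then cinner u (left_annihilation i z) else 0)))
      UNIV"
    by (rule has_sum_lists)
  then show ?thesis
    by (simp add: coeff_left_tensor infsumI cinner_ell2_def[of "left_tensor (axis i 1) u"])
qed

lemma left_creation_ket: "left_creation i (ket w) = ket (i # w)"
  by (rule ell2_eqI)
    (auto simp: left_creation_def coeff_left_tensor coeff_ket axis_def scaleC_complex_def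
      split: list.split)

lemma coeff_sum_ell2: "coeff (\<Sum>i\<in>A. f i) w = (\<Sum>i\<in>A. coeff (f i) w)"
  by (induction A rule: infinite_finite_induct) auto

text \<open>Each word is either empty, giving the vacuum term, or begins with exactly one letter, so
  that exactly one summand contributes to its coefficient.\<close>

lemma wold_decomposition:
  fixes z :: "('n::finite list, 'd::chilbert_space) ell2"
  shows "z = vacuum \<otimes> coeff z [] + (\<Sum>i\<in>UNIV. left_tensor (axis i 1) (left_annihilation i z))"
proof (rule ell2_eqI)
  fix w
  show "coeff z w = coeff (vacuum \<otimes> coeff z []
      + (\<Sum>i\<in>UNIV. left_tensor (axis i 1) (left_annihilation i z))) w"
  proof (cases w)
    case (Cons j u)
    have "(\<Sum>i\<in>UNIV. (axis i 1 $ j) *\<^sub>C coeff z (i # u))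
        = (\<Sum>i\<in>UNIV. if j = i then coeff z (j # u) else 0)"
      by (rule sum.cong) (auto simp: axis_def scaleC_one)
    then show ?thesis using Cons by (simp add: coeff_sum_ell2 coeff_vacuum coeff_left_tensor)
  qed (simp add: coeff_sum_ell2 coeff_vacuum coeff_left_tensor scaleC_one)
qed

lemma left_creation_in_F_infty: "left_creation i \<in> F_infty"
  by (auto simp: F_infty_def wot_closed_algebra_def)

section \<open>Compressions to the orthogonal complement of an ideal\<close>

text \<open>For \<open>T \<in> J\<close> also \<open>left_creation i \<circ> T \<in> J\<close>, so
  moving the annihilation operator across the inner product pairs \<open>x\<close> with a vector in
  the range of an element of \<open>J\<close>.\<close>

lemma left_annihilation_N_space:
  assumes "wot_closed_ideal F_infty J" "x \<in> N_space J"
  shows "left_annihilation i x \<in> N_space J"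
  unfolding N_space_def orthogonal_complement_closure_cspan
  unfolding orthogonal_complement_def
proof (intro CollectI ballI)
  fix y assume "y \<in> {T \<phi> | T \<phi>. T \<in> J}"
  then obtain T \<phi> where y: "y = T \<phi>" and "T \<in> J" by (elim CollectE exE conjE)
  then have "left_creation i \<circ> T \<in> J"
    using assms(1) left_creation_in_F_infty[of i] unfolding wot_closed_ideal_def by blast
  then have "(left_creation i \<circ> T) \<phi> \<in> {T \<phi> | T \<phi>. T \<in> J}"
    by (intro CollectI exI[of _ "left_creation i \<circ> T"] exI[of _ \<phi>]) simp
  moreover have "x \<in> orthogonal_complement {T \<phi> | T \<phi>. T \<in> J}"
    using assms(2) unfolding N_space_def orthogonal_complement_closure_cspan .
  ultimately have "cinner x ((left_creation i \<circ> T) \<phi>) = 0"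
    by (rule orthogonal_complementD[rotated])
  then show "cinner (left_annihilation i x) y = 0"
    by (subst cinner_eq_0_commute)
      (simp add: y left_creation_def cinner_eq_0_commute[of x] cinner_left_tensor_axis)
qed

lemma left_annihilation_N_space_tensor:
  assumes "wot_closed_ideal F_infty J" "z \<in> N_space J \<otimes>\<^sub>s UNIV"
  shows "left_annihilation i z \<in> N_space J \<otimes>\<^sub>s UNIV"
proof -
  have "N_space J \<otimes>\<^sub>s UNIV \<subseteq> left_annihilation i -` (N_space J \<otimes>\<^sub>s UNIV)"
    using assms(1)
    by (intro subspace_tensor_least csubspace_closed_vimage bounded_clinear_on_left_annihilation
        subspace_tensor_closed)
      (auto simp: left_annihilation_tensor intro!: tensor_in left_annihilation_N_space)
  then show ?thesis using assms(2) by blast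
qed

section \<open>Words in the compressed creation operators\<close>

lemma B_word_Nil: "B_word J [] = id"
  by (simp add: B_word_def)

lemma B_word_Cons: "B_word J (i # \<alpha>) = B_op J i \<circ> B_word J \<alpha>"
  by (simp add: B_word_def)

lemma B_word_singleton: "B_word J [i] = B_op J i"
  by (simp add: B_word_def)

lemma B_word_append: "B_word J (\<alpha> @ \<beta>) = B_word J \<alpha> \<circ> B_word J \<beta>"
  by (induction \<alpha>) (simp_all add: B_word_Nil B_word_Cons comp_assoc)

text \<open>With P the projection onto \<open>N_space J\<close>, invariance of this space under
  annihilation gives P S_i P = P S_i. A product of compressions is therefore the compression of the
  product, and the product of creation operators sends the vacuum to
  \<open>ket \<alpha>\<close>.\<close>

lemma B_word_vacuum:
  assumes "wot_closed_ideal F_infty J" "vacuum \<in> N_space J"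
  shows "B_word J \<alpha> vacuum = proj (N_space J) (ket \<alpha>)"
proof (induction \<alpha>)
  case Nil
  show ?case
    using assms(2) by (simp add: B_word_Nil proj_ident N_space_closed flip: vacuum_eq_ket)
next
  case (Cons i \<alpha>)
  let ?P = "proj (N_space J)"
  have "?P (left_creation i (?P (ket \<alpha>))) = ?P (left_creation i (ket \<alpha>))"
  proof (rule proj_eq_projI[OF N_space_closed])
    show "left_creation i (?P (ket \<alpha>)) - left_creation i (ket \<alpha>)
        \<in> orthogonal_complement (N_space J)"
      using left_annihilation_N_space[OF assms(1)]
      by (auto simp: orthogonal_complement_def left_creation_def cinner_diff cinner_left_tensor_axis
          cinner_proj_left N_space_closed)
  qed
  then show ?case by (simp add: B_word_Cons Cons B_op_def left_creation_ket)
qed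

section \<open>Ampliations of these words and their adjoints\<close>

context
  fixes J :: "('n::finite fock \<Rightarrow> 'n fock) set"
begin

private abbreviation (input) NT :: "('n list, 'd::chilbert_space) ell2 set"
  where "NT \<equiv> N_space J \<otimes>\<^sub>s UNIV"

private abbreviation (input) amp :: "'n list \<Rightarrow> ('n list, 'd::chilbert_space) ell2 \<Rightarrow> ('n list, 'd) ell2"
  where "amp \<alpha> \<equiv> ampliation (N_space J) (B_word J \<alpha>)"

lemma B_word_in_N_space: "x \<in> N_space J \<Longrightarrow> B_word J \<alpha> x \<in> N_space J"
  using ampliation_B_word_ex[of J \<alpha>] by blast

lemma ampliation_B_word:
  shows "bounded_clinear_on NT (amp \<alpha> :: ('n list, 'd::chilbert_space) ell2 \<Rightarrow> _)"
    and "\<And>x d. x \<in> N_space J \<Longrightarrow> amp \<alpha> (x \<otimes> d) = B_word J \<alpha> x \<otimes> (d :: 'd)"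
    and "\<And>z. z \<in> NT \<Longrightarrow> amp \<alpha> z \<in> (NT :: ('n list, 'd) ell2 set)"
proof -
  obtain R :: "('n list, 'd) ell2 \<Rightarrow> ('n list, 'd) ell2" where R: "bounded_clinear_on NT R"
    "\<And>z. z \<in> NT \<Longrightarrow> R z \<in> NT" "\<And>x d. x \<in> N_space J \<Longrightarrow> R (x \<otimes> d) = B_word J \<alpha> x \<otimes> d"
    using ampliation_B_word_ex[of J \<alpha>] by blast
  note p = ampliation_props[OF R(1,3)]
  show "bounded_clinear_on NT (amp \<alpha> :: ('n list, 'd) ell2 \<Rightarrow> _)"
    "\<And>x d. x \<in> N_space J \<Longrightarrow> amp \<alpha> (x \<otimes> d) = B_word J \<alpha> x \<otimes> (d :: 'd)"
    using p(1,2) by blast+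
  show "\<And>z. z \<in> NT \<Longrightarrow> amp \<alpha> z \<in> (NT :: ('n list, 'd) ell2 set)"
    using p(3) R(2) by simp
qed

text \<open>Both sides are bounded operators that agree on elementary tensors; the same uniqueness
  argument gives the next two lemmas.\<close>

lemma ampliation_B_word_append:
  fixes z :: "('n list, 'd::chilbert_space) ell2"
  assumes "z \<in> NT"
  shows "amp (\<alpha> @ \<beta>) z = amp \<alpha> (amp \<beta> z)"
  using ampliation_B_word(1) _ _ assms
proof (rule ampliation_unique)
  show "bounded_clinear_on NT (\<lambda>z :: ('n list, 'd) ell2. amp \<alpha> (amp \<beta> z))"
    by (rule bounded_clinear_on_compose) (rule ampliation_B_word; assumption?)+
qed (simp add: ampliation_B_word(2) B_word_append[THEN fun_cong] B_word_in_N_space)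

lemma ampliation_B_word_Nil: "z \<in> NT \<Longrightarrow> amp [] z = z"
  using ampliation_B_word(1)
  by (rule ampliation_unique)
    (auto simp: ampliation_B_word(2)[of _ "[]"] B_word_Nil[THEN fun_cong] bounded_clinear_on_def
      intro: exI[of _ 1])

lemma ampliation_B_word_singleton:
  fixes z :: "('n list, 'd::chilbert_space) ell2"
  assumes "z \<in> NT"
  shows "amp [i] z = proj NT (left_tensor (axis i 1) z)"
  using ampliation_B_word(1) _ _ assms
proof (rule ampliation_unique)
  have "bounded_clinear_on UNIV (\<lambda>z :: ('n list, 'd) ell2. proj NT (left_tensor (axis i 1) z))"
    using bounded_clinear_on_left_tensor bounded_clinear_on_proj[OF subspace_tensor_closed]
    by (rule bounded_clinear_on_compose) simp
  then show "bounded_clinear_on NT (\<lambda>z :: ('n list, 'd) ell2. proj NT (left_tensor (axis i 1) z))"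
    by (auto simp: bounded_clinear_on_def)
qed (simp add: ampliation_B_word(2) B_word_singleton[THEN fun_cong] B_op_def left_creation_def
      left_tensor_tensor proj_tensor N_space_closed)

text \<open>The ampliation is linear only on \<open>N_space J \<otimes>\<^sub>s UNIV\<close>.
  Precomposing with the projection makes it a bounded operator on the whole space, so that the
  preimage argument reduces the claim to elementary tensors.\<close>

lemma ampliation_B_word_subspace_tensor:
  fixes z :: "('n list, 'd::chilbert_space) ell2"
  assumes "z \<in> N_space J \<otimes>\<^sub>s E"
  shows "amp \<alpha> z \<in> N_space J \<otimes>\<^sub>s E"
proof -
  let ?P = "proj NT :: ('n list, 'd) ell2 \<Rightarrow> _"
  have P: "?P u = u" if "u \<in> NT" for u
    using that by (simp add: proj_ident subspace_tensor_closed)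
  have "bounded_clinear_on UNIV (\<lambda>z. amp \<alpha> (?P z))"
    using bounded_clinear_on_proj[OF subspace_tensor_closed] ampliation_B_word(1)
    by (rule bounded_clinear_on_compose) (simp add: proj_props subspace_tensor_closed)
  note cl = csubspace_closed_vimage[OF this subspace_tensor_closed]
  have "N_space J \<otimes>\<^sub>s E \<subseteq> (\<lambda>z. amp \<alpha> (?P z)) -` (N_space J \<otimes>\<^sub>s E)"
    by (intro subspace_tensor_least cl)
      (simp add: P tensor_in ampliation_B_word(2) B_word_in_N_space)
  moreover have "z \<in> NT" using assms subspace_tensor_mono[of "N_space J" "N_space J" E UNIV] by blast
  ultimately show ?thesis using assms P by auto
qed

text \<open>The ampliation is the compression of the creation operator, and annihilation leaves the
  compressed space invariant, so the adjoint is a plain restriction without a projection.\<close>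

lemma adjoint_ampliation_B_op:
  fixes z :: "('n list, 'd::chilbert_space) ell2"
  assumes "wot_closed_ideal F_infty J" "z \<in> NT"
  shows "adjoint_on NT (ampliation (N_space J) (B_op J i)) z = left_annihilation i z"
proof (rule adjoint_on_eqI)
  show "cinner (ampliation (N_space J) (B_op J i) u) z = cinner u (left_annihilation i z)"
    if "u \<in> NT" for u
    using that assms(2)
    by (simp add: cinner_proj_left subspace_tensor_closed cinner_left_tensor_axis
        ampliation_B_word_singleton flip: B_word_singleton)
qed (simp_all add: subspace_tensor_closed left_annihilation_N_space_tensor assms)

text \<open>Project the decomposition of \<open>z\<close>: both \<open>z\<close> and the vacuum term
  are fixed, and each remaining term becomes a compressed creation operator.\<close>

lemma vacuum_tensor_coeff:
  fixes z :: "('n list, 'd::chilbert_space) ell2"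
  assumes "wot_closed_ideal F_infty J" "vacuum \<in> N_space J" "z \<in> NT"
  shows "vacuum \<otimes> coeff z [] + (\<Sum>i\<in>UNIV. amp [i] (left_annihilation i z)) = z"
proof -
  let ?P = "proj NT :: ('n list, 'd) ell2 \<Rightarrow> _"
  interpret P: bounded_linear ?P
    by (intro bounded_clinear_on_imp_bounded_linear bounded_clinear_on_proj subspace_tensor_closed)
  have "?P z = ?P (vacuum \<otimes> coeff z []
      + (\<Sum>i\<in>UNIV. left_tensor (axis i 1) (left_annihilation i z)))"
    using wold_decomposition[of z] by simp
  also have "\<dots> = vacuum \<otimes> coeff z []
      + (\<Sum>i\<in>UNIV. ?P (left_tensor (axis i 1) (left_annihilation i z)))"
    unfolding P.add P.sum by (simp add: proj_ident subspace_tensor_closed tensor_in assms)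
  finally show ?thesis
    by (simp add: ampliation_B_word_singleton left_annihilation_N_space_tensor assms
        proj_ident subspace_tensor_closed)
qed

end

theorem theorem1p5:
  fixes J :: "('n::finite fock \<Rightarrow> 'n fock) set"
    and M :: "('n list, 'd::chilbert_space) ell2 set"
  assumes "wot_closed_ideal F_infty J"
    and "vacuum \<in> N_space J"
    and "csubspace M"
    and "M \<subseteq> N_space J \<otimes>\<^sub>s UNIV"
    and "coinvariant (N_space J \<otimes>\<^sub>s UNIV) (range (\<lambda>i. ampliation (N_space J) (B_op J i))) M"
  shows "\<exists>E :: 'd set. csubspace E \<and> closed E \<and>
    closure (cspan (\<Union>\<alpha>. ampliation (N_space J) (B_word J \<alpha>) ` M)) = N_space J \<otimes>\<^sub>s E"
proof -
  let ?A = "\<lambda>\<alpha>. ampliation (N_space J) (B_word J \<alpha>) :: ('n list, 'd) ell2 \<Rightarrow> _"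
  let ?NT = "N_space J \<otimes>\<^sub>s UNIV :: ('n list, 'd) ell2 set"
  define E0 where "E0 = (\<lambda>z. coeff z []) ` M"
  define S where "S = cspan (\<Union>\<alpha>. ?A \<alpha> ` M)"
  define L where "L = closure S"
  have S: "csubspace S" unfolding S_def by (rule complex_vector.subspace_span)
  have L: "csubspace L" "closed L" unfolding L_def using S by (auto intro: csubspace_closure)
  have AM: "?A \<alpha> z \<in> S" if "z \<in> M" for \<alpha> z
    unfolding S_def using that by (intro complex_vector.span_base) auto
  have MN: "z \<in> ?NT" if "z \<in> M" for z using that assms(4) by blast
  \<comment> \<open>Co-invariance becomes a statement about shifted coefficients.\<close>
  have Mann: "left_annihilation i z \<in> M" if z: "z \<in> M" for i z
    using assms(5)[unfolded coinvariant_def, rule_format, OF rangeI z]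
    by (simp add: adjoint_ampliation_B_op[OF assms(1) MN[OF z]])
  have "csubspace E0"
    unfolding complex_vector.subspace_def
  proof (intro conjI ballI allI)
    show "0 \<in> E0"
      using complex_vector.subspace_0[OF assms(3)] unfolding E0_def by (rule rev_image_eqI) simp
  next
    fix d d' assume "d \<in> E0" "d' \<in> E0"
    then obtain y z where "y \<in> M" "z \<in> M" "d = coeff y []" "d' = coeff z []"
      by (auto simp: E0_def)
    then show "d + d' \<in> E0"
      unfolding E0_def
      by (intro rev_image_eqI[of "y + z"] complex_vector.subspace_add assms(3)) simp_all
  next
    fix c d assume "d \<in> E0"
    then obtain z where "z \<in> M" "d = coeff z []" by (auto simp: E0_def)
    then show "c *\<^sub>C d \<in> E0"
      unfolding E0_def
      by (intro rev_image_eqI[of "c *\<^sub>C z"] complex_vector.subspace_scale assms(3)) simp_all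
  qed
  then have E: "csubspace (closure E0)" "closed (closure E0)"
    by (auto intro: csubspace_closure)

  \<comment> \<open>The coefficient of \<open>z\<close> at \<open>i # w\<close> is the one of
    \<open>left_annihilation i z\<close>, again in \<open>M\<close>, at \<open>w\<close>; so every
    coefficient reduces to one at the empty word.\<close>
  have coeff: "coeff z w \<in> E0" if "z \<in> M" for z w
    using that
  proof (induction w arbitrary: z)
    case (Cons i w)
    then show ?case using Mann[of z i] by (metis coeff_left_annihilation)
  qed (simp add: E0_def)
  have "L \<subseteq> N_space J \<otimes>\<^sub>s closure E0"
    unfolding L_def S_def
  proof (intro closure_minimal complex_vector.span_minimal subspace_tensor_closed UN_least image_subsetI)
    fix \<alpha> z assume z: "z \<in> M"
    have "z \<in> N_space J \<otimes>\<^sub>s closure E0"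
      by (rule in_subspace_tensorI[OF N_space_closed MN[OF z] subsetD[OF closure_subset coeff[OF z]]])
    then show "?A \<alpha> z \<in> N_space J \<otimes>\<^sub>s closure E0" by (rule ampliation_B_word_subspace_tensor)
  qed
  moreover have "N_space J \<otimes>\<^sub>s closure E0 \<subseteq> L"
  proof (rule subspace_tensor_least[OF L])
    \<comment> \<open>Solve the decomposition of \<open>z\<close> for the vacuum term and apply
      \<open>?A \<alpha>\<close>: the words \<open>\<alpha>\<close> and
      \<open>\<alpha> @ [i]\<close> then act only on elements of \<open>M\<close>.\<close>
    have word: "proj (N_space J) (ket \<alpha>) \<otimes> coeff z [] \<in> L" if z: "z \<in> M" for \<alpha> z
    proof -
      let ?s = "\<Sum>i\<in>UNIV. ?A [i] (left_annihilation i z)"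
      have v: "vacuum \<otimes> coeff z [] \<in> ?NT" using assms(2) by (simp add: tensor_in)
      have s: "?A [i] (left_annihilation i z) \<in> ?NT" for i
        by (intro ampliation_B_word(3) MN Mann z)
      have "?A \<alpha> z = ?A \<alpha> (vacuum \<otimes> coeff z [] + ?s)"
        by (simp add: vacuum_tensor_coeff assms MN z)
      also have "\<dots> = ?A \<alpha> (vacuum \<otimes> coeff z []) + ?A \<alpha> ?s"
        by (intro ampliation_B_word(1)[unfolded bounded_clinear_on_def, THEN conjunct1, rule_format]
            v s complex_vector.subspace_sum subspace_tensor_closed)
      also have "?A \<alpha> ?s = (\<Sum>i\<in>UNIV. ?A \<alpha> (?A [i] (left_annihilation i z)))"
        by (rule bounded_clinear_on_sum[OF ampliation_B_word(1) subspace_tensor_closed(1) s])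
      also have "\<dots> = (\<Sum>i\<in>UNIV. ?A (\<alpha> @ [i]) (left_annihilation i z))"
        by (simp add: ampliation_B_word_append MN Mann z)
      finally have "proj (N_space J) (ket \<alpha>) \<otimes> coeff z []
          = ?A \<alpha> z - (\<Sum>i\<in>UNIV. ?A (\<alpha> @ [i]) (left_annihilation i z))"
        by (simp add: ampliation_B_word(2) assms B_word_vacuum)
      also have "\<dots> \<in> S"
        by (intro complex_vector.subspace_diff complex_vector.subspace_sum S AM Mann z)
      finally show ?thesis unfolding L_def using closure_subset by blast
    qed
    fix x d assume x: "x \<in> N_space J" and d: "d \<in> closure E0"
    have "x \<otimes> coeff z [] \<in> L" if z: "z \<in> M" for z
    proof -
      \<comment> \<open>The basis vectors need not lie in \<open>N_space J\<close>, so
        \<open>x\<close> first ranges over the whole Fock space with the projection inserted;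
        \<open>word\<close> covers the basis, and the projection fixes the given
        \<open>x\<close>.\<close>
      have "bounded_clinear_on UNIV (\<lambda>x. proj (N_space J) x \<otimes> coeff z [])"
        using bounded_clinear_on_proj[OF N_space_closed] bounded_clinear_on_tensor_left
        by (rule bounded_clinear_on_compose) simp
      from csubspace_closed_vimage[OF this L]
      have "(\<lambda>x. proj (N_space J) x \<otimes> coeff z []) -` L = UNIV"
        by (rule closed_csubspace_eq_UNIV) (simp add: word z)
      then show ?thesis using proj_ident[OF N_space_closed x] by (metis UNIV_I vimageE)
    qed
    \<comment> \<open>Continuity in the second tensor factor extends this from \<open>E0\<close> to
      its closure.\<close>
    then have "E0 \<subseteq> (\<lambda>d. x \<otimes> d) -` L" by (auto simp: E0_def)
    then have "closure E0 \<subseteq> (\<lambda>d. x \<otimes> d) -` L"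
      by (intro closure_minimal csubspace_closed_vimage(2)[OF bounded_clinear_on_tensor_right L])
    then show "x \<otimes> d \<in> L" using d by blast
  qed
  ultimately show ?thesis using E unfolding L_def S_def by blast
qed

end
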